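(* Let $R$ be an $n\times n$ expanding integer matrix, and let $\mathcal{D}\subset\mathbb{Z}^n$ be a set with $0\in\mathcal{D}$ and $\#\mathcal{D}=|\det(R)|$. Suppose that $T(R,\mathcal{D})$ is a self-affine tile. Then the following are equivalent. (i) There exist an integer $m\ge1$ and a full-periodic set $\mathcal{J}$ with period $R^m$ such that $0\in\mathcal{J}$ and $\mathcal{J}=R^m\mathcal{J}+\mathcal{D}_m$. (ii) There exists an integer $m\ge1$ such that $\mathcal{D}_m$ is a skew-product-form digit set with respect to $R^m$. (iii) There exists an integer $m\ge1$ such that $\mathcal{J}_{m+1}^*=\mathcal{J}_{m}^*$.
   Context: An $n\times n$ integer matrix $R$ is expanding if all its eigenvalues have modulus strictly larger than $1$. For a finite set $\mathcal{D}\subset\mathbb{Z}^n$ with $\#\mathcal{D}=|\det R|$, $T(R,\mathcal{D})$ denotes the unique non-empty compact set $T\subset\mathbb{R}^n$ satisfying $T=\bigcup_{d\in\mathcal{D}}R^{-1}(T+d)$. It is called an (integral) self-affine tile if it has non-empty interior. For $k\ge 1$, $\mathcal{D}_k=\mathcal{D}+R\mathcal{D}+\cdots+R^{k-1}\mathcal{D}$. Define $\mathcal{J}_0^*=\mathbb{Z}^n$ and $\mathcal{J}_k^*=R\mathcal{J}_{k-1}^*+\mathcal{D}$ for $k\ge 1$. A set $A\subset\mathbb{R}^n$ is full-periodic with period $B$, where $B$ is a nonsingular integer matrix, if there is a finite set $\mathcal{C}\subset\mathbb{Z}^n$ with $A=B\mathbb{Z}^n+\mathcal{C}$. A complete residue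 set modulo an expanding integer matrix $Q$ is a subset of $\mathbb{Z}^n$ containing exactly one element of each coset of $Q\mathbb{Z}^n$ in $\mathbb{Z}^n$. $\mathcal{A}\oplus\mathcal{B}$ denotes the sumset $\mathcal{A}+\mathcal{B}$ when all sums $a+b$ ($a\in\mathcal{A}$, $b\in\mathcal{B}$) are distinct. A set $\mathcal{E}\subset\mathbb{Z}^n$ with $\#\mathcal{E}=|\det Q|$ is a skew-product-form digit set with respect to $Q$ if there exist $\mathcal{A}=\{a_j\}_{j=0}^{s-1}\subset\mathbb{Z}^n$ (with $s$ distinct elements) and $\mathcal{B}_0,\dots,\mathcal{B}_{s-1}\subset\mathbb{Z}^n$ such that $\mathcal{E}=\bigcup_{j=0}^{s-1}(a_j+Q\mathcal{B}_j)$ and, for each $j$, the sum $\mathcal{A}+\mathcal{B}_j$ is direct and $\mathcal{A}\oplus\mathcal{B}_j$ is a complete residue set modulo $Q$. *)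

theory Defs
  imports "HOL-Analysis.Analysis"
begin

text \<open>
  The index type \<open>'n\<close> plays the role of the dimension; the lattice of integer points is the type
  \<open>int ^ 'n\<close>. On sets, \<open>+\<close> and sums are Minkowski sums (theory \<open>Set_Algebras\<close>).
\<close>

definition real_vec :: "int ^ 'n \<Rightarrow> real ^ 'n::finite" where
  "real_vec v = (\<chi> i. real_of_int (v $ i))"

definition real_mat :: "int ^ 'n ^ 'n \<Rightarrow> real ^ 'n ^ 'n::finite" where
  "real_mat = map_matrix real_of_int"

definition complex_mat :: "int ^ 'n ^ 'n \<Rightarrow> complex ^ 'n ^ 'n::finite" where
  "complex_mat = map_matrix of_int"

text \<open>
  The type-class power \<open>R ^ k\<close> on \<open>int ^ 'n ^ 'n\<close> is the entrywise one, hence this definition.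
\<close>

primrec matpow :: "int ^ 'n ^ 'n \<Rightarrow> nat \<Rightarrow> int ^ 'n ^ 'n::finite" where
  "matpow R 0 = mat 1"
| "matpow R (Suc k) = R ** matpow R k"

definition expanding :: "int ^ 'n ^ 'n::finite \<Rightarrow> bool" where
  "expanding R \<longleftrightarrow> (\<forall>c v. v \<noteq> 0 \<and> complex_mat R *v v = c *s v \<longrightarrow> cmod c > 1)"

text \<open>
  For expanding \<open>R\<close> and finite non-empty \<open>D\<close> the set described here exists and is unique, being
  the attractor of an iterated function system that is contractive for a suitable norm.
\<close>

definition self_affine_set :: "int ^ 'n ^ 'n \<Rightarrow> (int ^ 'n) set \<Rightarrow> (real ^ 'n::finite) set" where
  "self_affine_set R D =
     (THE T. compact T \<and> T \<noteq> {} \<and>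
        T = (\<Union>d\<in>D. (\<lambda>x. matrix_inv (real_mat R) *v (x + real_vec d)) ` T))"

definition is_self_affine_tile :: "int ^ 'n ^ 'n \<Rightarrow> (int ^ 'n::finite) set \<Rightarrow> bool" where
  "is_self_affine_tile R D \<longleftrightarrow> interior (self_affine_set R D) \<noteq> {}"

definition iter_digits :: "int ^ 'n ^ 'n \<Rightarrow> (int ^ 'n) set \<Rightarrow> nat \<Rightarrow> (int ^ 'n::finite) set" where
  "iter_digits R D k = (\<Sum>i<k. (*v) (matpow R i) ` D)"

primrec Jstar :: "int ^ 'n ^ 'n \<Rightarrow> (int ^ 'n) set \<Rightarrow> nat \<Rightarrow> (int ^ 'n::finite) set" where
  "Jstar R D 0 = UNIV"
| "Jstar R D (Suc k) = (*v) R ` Jstar R D k + D"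

text \<open>
  A set of the form \<open>B \<int>\<^sup>n + C\<close> with integral \<open>B\<close> and \<open>C\<close> consists of integer points, so only
  subsets of \<open>\<int>\<^sup>n\<close> need to be considered.
\<close>

definition full_periodic :: "int ^ 'n ^ 'n \<Rightarrow> (int ^ 'n::finite) set \<Rightarrow> bool" where
  "full_periodic B A \<longleftrightarrow> det B \<noteq> 0 \<and> (\<exists>C. finite C \<and> A = range ((*v) B) + C)"

definition complete_residue_set :: "int ^ 'n ^ 'n \<Rightarrow> (int ^ 'n::finite) set \<Rightarrow> bool" where
  "complete_residue_set Q S \<longleftrightarrow> (\<forall>x. \<exists>!s. s \<in> S \<and> s \<in> {x} + range ((*v) Q))"

definition direct_sum_set :: "'a::plus set \<Rightarrow> 'a set \<Rightarrow> bool" where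
  "direct_sum_set A B \<longleftrightarrow> inj_on (\<lambda>(a, b). a + b) (A \<times> B)"

definition skew_product_form :: "int ^ 'n ^ 'n \<Rightarrow> (int ^ 'n::finite) set \<Rightarrow> bool" where
  "skew_product_form Q E \<longleftrightarrow>
     finite E \<and> int (card E) = \<bar>det Q\<bar> \<and>
     (\<exists>(s::nat) (a :: nat \<Rightarrow> int ^ 'n) (B :: nat \<Rightarrow> (int ^ 'n) set).
        inj_on a {..<s} \<and>
        E = (\<Union>j<s. {a j} + (*v) Q ` B j) \<and>
        (\<forall>j<s. direct_sum_set (a ` {..<s}) (B j) \<and>
               complete_residue_set Q (a ` {..<s} + B j)))"

end

theory Submission
  imports Defs "HOL-Computational_Algebra.Fundamental_Theorem_Algebra"
begin

text \<open>
  Write \<open>Q = R\<^sup>m\<close> and \<open>E = D\<^sub>m\<close>. Unrolling the recursion gives \<open>J\<^sub>k\<^sup>* = R\<^sup>k \<int>\<^sup>n + D\<^sub>k\<close>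
  (\<open>Jstar_eq\<close>), a decreasing sequence of periodic sets. The three conditions are equivalent for
  each single \<open>m \<ge> 1\<close>.

  A \<open>Q\<close>-periodic solution of \<open>J = Q J + E\<close> that contains \<open>0\<close> contains \<open>E\<close> and hence can only be
  \<open>Q \<int>\<^sup>n + E = J\<^sub>m\<^sup>*\<close>. For this set the equation says \<open>J\<^sub>2\<^sub>m\<^sup>* = J\<^sub>m\<^sup>*\<close>, which by monotonicity
  is \<open>J\<^sub>m\<^sub>+\<^sub>1\<^sup>* = J\<^sub>m\<^sup>*\<close> (\<open>periodic_solution_iff_Jstar_stable\<close>).

  If \<open>E = \<Union>\<^sub>j (a\<^sub>j + Q B\<^sub>j)\<close> is in skew-product form, then \<open>A + B\<^sub>j + Q \<int>\<^sup>n = \<int>\<^sup>n\<close> makes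
  \<open>J = A + Q \<int>\<^sup>n\<close> a solution (\<open>skew_product_form_imp_periodic_solution\<close>). Conversely, let
  \<open>J = Q \<int>\<^sup>n + E\<close> solve the equation, let \<open>A\<close> represent the residues of \<open>E\<close> modulo \<open>Q\<close>, and split
  \<open>E\<close> into its fibres \<open>a\<^sub>j + Q B\<^sub>j\<close>. Comparing the parts of \<open>J\<close> and of \<open>Q J + E\<close> in the class of
  \<open>a\<^sub>j\<close> shows that \<open>A + B\<^sub>j\<close> meets every class, so \<open>#A #B\<^sub>j \<ge> |det Q|\<close>. As the \<open>#A\<close> numbers
  \<open>#B\<^sub>j\<close> add up to \<open>#E = |det Q|\<close>, equality holds for each \<open>j\<close>, and equality makes the sum direct and
  a complete residue set (\<open>skew_product_form_if_invariant\<close>). The index bound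
  behind this is a volume comparison (\<open>card_ge_abs_det_if_cover\<close>).

  The tile provides the count \<open>#D\<^sub>m = |det R|\<^sup>m\<close> (\<open>card_iter_digits_if_tile\<close>): \<open>T\<close> is a union of
  \<open>#D\<^sub>m\<close> translates of \<open>R\<^sup>-\<^sup>m T\<close>, so its positive volume forces \<open>#D\<^sub>m \<ge> |det R|\<^sup>m\<close>. To know that
  \<open>T\<close> satisfies its defining equation at all, the attractor has to be shown to exist uniquely, which
  rests on \<open>R\<^sup>-\<^sup>k \<longrightarrow> 0\<close> for expanding \<open>R\<close>.
\<close>

section \<open>Iterated digit sets and the sets \<open>J\<^sub>k\<^sup>*\<close>\<close>

lemma abs_det_matpow: "\<bar>det (matpow R k)\<bar> = \<bar>det R\<bar> ^ k"
  by (induction k) (simp_all add: det_mul abs_mult)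

lemma matrix_image_set_plus:
  fixes A :: "'a::comm_ring_1 ^ 'n ^ 'm"
  shows "(*v) A ` (S + T) = (*v) A ` S + (*v) A ` T"
proof -
  have "A *v (s + t) \<in> (*v) A ` S + (*v) A ` T" if "s \<in> S" "t \<in> T" for s t
    using that by (auto simp: matrix_vector_right_distrib)
  moreover have "A *v s + A *v t \<in> (*v) A ` (S + T)" if "s \<in> S" "t \<in> T" for s t
    using that by (auto simp flip: matrix_vector_right_distrib)
  ultimately show ?thesis
    by (auto elim!: set_plus_elim)
qed

lemma matrix_image_mult:
  fixes A :: "'a::comm_ring_1 ^ 'n ^ 'm"
  shows "(*v) (A ** B) ` S = (*v) A ` ((*v) B ` S)"
  by (simp add: image_image matrix_vector_mul_assoc)

lemma iter_digits_0 [simp]: "iter_digits R D 0 = {0}"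
  by (simp add: iter_digits_def)

text \<open>
  The definition of \<open>iter_digits\<close> splits off the summand with the highest power of \<open>R\<close>. Splitting
  off the lowest one instead is what matches the recursion of \<open>Jstar\<close> and the equation of the tile.
\<close>
lemma iter_digits_Suc:
  "iter_digits R D (Suc k) = D + (*v) R ` iter_digits R D k"
proof (induction k)
  case 0
  show ?case
    by (simp add: iter_digits_def)
next
  case (Suc k)
  have split: "iter_digits R D (Suc j) = iter_digits R D j + (*v) (matpow R j) ` D" for j
    by (simp add: iter_digits_def)
  show ?case
    by (subst split, subst Suc.IH)
       (simp add: split matrix_image_set_plus matrix_image_mult add.assoc)
qed

lemma zero_in_iter_digits: "0 \<in> D \<Longrightarrow> 0 \<in> iter_digits R D k"
proof (induction k)
  case (Suc k)
  then have "0 + R *v 0 \<in> D + (*v) R ` iter_digits R D k"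
    by blast
  then show ?case
    by (simp add: iter_digits_Suc)
qed simp

lemma finite_iter_digits: "finite D \<Longrightarrow> finite (iter_digits R D k)"
  by (induction k) (simp_all add: iter_digits_Suc finite_set_plus)

lemma Jstar_add: "Jstar R D (k + j) = (*v) (matpow R j) ` Jstar R D k + iter_digits R D j"
  by (induction j)
     (simp_all add: iter_digits_Suc matrix_image_set_plus matrix_image_mult ac_simps)

lemma Jstar_eq: "Jstar R D k = range ((*v) (matpow R k)) + iter_digits R D k"
  using Jstar_add[of R D 0 k] by simp

text \<open>
  \<open>J\<^sub>1\<^sup>* \<subseteq> \<int>\<^sup>n = J\<^sub>0\<^sup>*\<close>, and \<open>X \<mapsto> R X + D\<close> is monotone.
\<close>
lemma Jstar_Suc_subset: "Jstar R D (Suc k) \<subseteq> Jstar R D k"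
proof (induction k)
  case (Suc k)
  then show ?case
    unfolding Jstar.simps(2) by (intro set_plus_mono2 image_mono) auto
qed simp

lemma Jstar_antimono: "j \<le> k \<Longrightarrow> Jstar R D k \<subseteq> Jstar R D j"
  using lift_Suc_antimono_le[of "Jstar R D"] Jstar_Suc_subset by blast

lemma Jstar_stable:
  assumes "Jstar R D (Suc m) = Jstar R D m"
  shows "Jstar R D (m + j) = Jstar R D m"
  by (induction j) (use assms in simp_all)

section \<open>Periodic solutions of the digit equation\<close>

lemma period_image_set_plus:
  fixes Q :: "int ^ 'n ^ 'n"
  shows "range ((*v) Q) + (range ((*v) Q) + C) = range ((*v) Q) + C"
proof -
  have "range ((*v) Q) + range ((*v) Q) = range ((*v) Q)"
    by (simp flip: matrix_image_set_plus) (simp add: set_plus_def image_def, metis add.right_neutral)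
  then show ?thesis
    by (simp flip: add.assoc)
qed

text \<open>
  Since \<open>0 \<in> J\<close>, the equation gives \<open>E = Q 0 + E \<subseteq> J\<close>, and periodicity then gives
  \<open>Q \<int>\<^sup>n + E \<subseteq> J\<close>; the other inclusion holds because \<open>J \<subseteq> \<int>\<^sup>n\<close>.
\<close>
lemma periodic_solution_unique:
  fixes Q :: "int ^ 'n ^ 'n::finite"
  assumes C: "J = range ((*v) Q) + C"
    and zero: "0 \<in> J"
    and eq: "J = (*v) Q ` J + E"
  shows "J = range ((*v) Q) + E"
proof
  show "J \<subseteq> range ((*v) Q) + E"
    by (subst eq, rule set_plus_mono2) auto
  have "(*v) Q 0 \<in> (*v) Q ` J"
    using zero by blast
  then have "{0} + E \<subseteq> (*v) Q ` J + E"
    by (intro set_plus_mono2) auto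
  then have "E \<subseteq> J"
    using eq by simp
  then have "range ((*v) Q) + E \<subseteq> range ((*v) Q) + J"
    by (intro set_plus_mono2) auto
  also have "\<dots> = J"
    unfolding C by (rule period_image_set_plus)
  finally show "range ((*v) Q) + E \<subseteq> J" .
qed

text \<open>
  By uniqueness the only candidate is \<open>J\<^sub>m\<^sup>*\<close>, for which the equation reads \<open>J\<^sub>2\<^sub>m\<^sup>* = J\<^sub>m\<^sup>*\<close>. As
  the sequence decreases, this collapses \<open>J\<^sub>m\<^sup>*, \<dots>, J\<^sub>2\<^sub>m\<^sup>*\<close> to one set.
\<close>
lemma periodic_solution_iff_Jstar_stable:
  fixes R :: "int ^ 'n ^ 'n::finite"
  assumes "det R \<noteq> 0" "0 \<in> D" "finite D" "m \<ge> 1"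
  shows "(\<exists>J. full_periodic (matpow R m) J \<and> 0 \<in> J \<and>
              J = (*v) (matpow R m) ` J + iter_digits R D m)
         \<longleftrightarrow> Jstar R D (m + 1) = Jstar R D m"
proof
  assume "\<exists>J. full_periodic (matpow R m) J \<and> 0 \<in> J \<and>
              J = (*v) (matpow R m) ` J + iter_digits R D m"
  then obtain J C where J: "J = range ((*v) (matpow R m)) + C" "0 \<in> J"
      "J = (*v) (matpow R m) ` J + iter_digits R D m"
    unfolding full_periodic_def by blast
  have "J = Jstar R D m"
    using periodic_solution_unique[OF J] by (simp add: Jstar_eq)
  with J(3) have "Jstar R D (m + m) = Jstar R D m"
    by (simp only: Jstar_add)
  moreover have "Jstar R D (m + m) \<subseteq> Jstar R D (m + 1)" "Jstar R D (m + 1) \<subseteq> Jstar R D m"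
    using \<open>m \<ge> 1\<close> by (intro Jstar_antimono; simp)+
  ultimately show "Jstar R D (m + 1) = Jstar R D m"
    by blast
next
  assume "Jstar R D (m + 1) = Jstar R D m"
  then have "Jstar R D m = (*v) (matpow R m) ` Jstar R D m + iter_digits R D m"
    using Jstar_stable[of R D m m] Jstar_add[of R D m m] by simp
  moreover have "0 \<in> Jstar R D m"
  proof -
    have "matpow R m *v 0 + 0 \<in> Jstar R D m"
      unfolding Jstar_eq using zero_in_iter_digits[OF \<open>0 \<in> D\<close>] by blast
    then show ?thesis by simp
  qed
  moreover have "full_periodic (matpow R m) (Jstar R D m)"
  proof -
    have "\<bar>det (matpow R m)\<bar> \<noteq> 0"
      using \<open>det R \<noteq> 0\<close> by (simp add: abs_det_matpow)
    then show ?thesis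
      unfolding full_periodic_def Jstar_eq using finite_iter_digits[OF \<open>finite D\<close>] by auto
  qed
  ultimately show "\<exists>J. full_periodic (matpow R m) J \<and> 0 \<in> J \<and>
      J = (*v) (matpow R m) ` J + iter_digits R D m"
    by blast
qed

section \<open>Skew-product-form digit sets\<close>

lemma complete_residue_set_cover:
  assumes "complete_residue_set Q S"
  shows "range ((*v) Q) + S = UNIV"
proof -
  have "x \<in> range ((*v) Q) + S" for x
  proof -
    obtain s where s: "s \<in> S" "s \<in> {x} + range ((*v) Q)"
      using assms unfolding complete_residue_set_def by blast
    then obtain v where "s = x + Q *v v"
      by (auto elim!: set_plus_elim)
    then have "x = Q *v (- v) + s"
      using matrix_vector_right_distrib[of Q "- v" v] by (simp add: algebra_simps)
    then show ?thesis
      using s by blast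
  qed
  then show ?thesis by blast
qed

text \<open>
  Take \<open>J = Q \<int>\<^sup>n + A\<close>. The part \<open>Q J + a\<^sub>j + Q B\<^sub>j\<close> of \<open>Q J + E\<close> is \<open>a\<^sub>j + Q (\<int>\<^sup>n)\<close>, because
  \<open>J + B\<^sub>j\<close> is all of \<open>\<int>\<^sup>n\<close>; the union of these over \<open>j\<close> is \<open>J\<close> again.
\<close>
lemma skew_product_form_imp_periodic_solution:
  fixes Q :: "int ^ 'n ^ 'n::finite"
  assumes skew: "skew_product_form Q E" and det: "det Q \<noteq> 0" and zero: "0 \<in> E"
  shows "\<exists>J. full_periodic Q J \<and> 0 \<in> J \<and> J = (*v) Q ` J + E"
proof -
  obtain s :: nat and a :: "nat \<Rightarrow> int ^ 'n" and B where
    E: "E = (\<Union>j<s. {a j} + (*v) Q ` B j)" and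
    res: "\<And>j. j < s \<Longrightarrow> complete_residue_set Q (a ` {..<s} + B j)"
    using skew unfolding skew_product_form_def by blast
  define A where "A = a ` {..<s}"
  define J where "J = range ((*v) Q) + A"
  have per: "range ((*v) Q) = (*v) Q ` (J + B j)" if "j < s" for j
    using complete_residue_set_cover[OF res[OF that]] by (simp add: J_def A_def add.assoc)
  have "(*v) Q ` J + E = (\<Union>j<s. (*v) Q ` J + ({a j} + (*v) Q ` B j))"
    unfolding E by (auto simp: set_plus_def)
  also have "\<dots> = (\<Union>j<s. {a j} + (*v) Q ` (J + B j))"
    by (simp add: matrix_image_set_plus ac_simps)
  also have "\<dots> = (\<Union>j<s. {a j} + range ((*v) Q))"
    using per by (intro SUP_cong) auto
  also have "\<dots> = J"
    by (auto simp: J_def A_def set_plus_def add.commute)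
  finally have eq: "J = (*v) Q ` J + E" ..
  have "0 \<in> J"
  proof -
    obtain j b where "j < s" "0 = a j + Q *v b"
      using zero unfolding E by (auto elim!: set_plus_elim)
    then show ?thesis
      unfolding J_def A_def using set_plus_intro[of "Q *v b" "range ((*v) Q)" "a j" "a ` {..<s}"]
      by (simp add: add.commute)
  qed
  moreover have "full_periodic Q J"
    using det unfolding full_periodic_def J_def A_def by blast
  ultimately show ?thesis
    using eq by blast
qed

section \<open>Volume of linear images\<close>

text \<open>
  The scaling law for volumes, stated as a property of a matrix so that it can be carried through
  an induction over products of elementary matrices.
\<close>
definition scales_measure :: "real ^ 'n ^ 'n::finite \<Rightarrow> bool" where
  "scales_measure A \<longleftrightarrow> (\<forall>S\<in>lmeasurable. (*v) A ` S \<in> lmeasurable \<and>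
     measure lebesgue ((*v) A ` S) = \<bar>det A\<bar> * measure lebesgue S)"

text \<open>
  A box with lower corner \<open>a\<close> is the translate by \<open>a\<close> of a box at the origin, and linear images
  turn this into a translation by \<open>A a\<close>. Testing on boxes at the origin keeps the coordinates
  nonnegative, which the shear below needs.
\<close>
lemma scales_measure_if_boxes:
  assumes box: "\<And>b. (\<And>i. 0 \<le> b $ i) \<Longrightarrow>
    measure lebesgue ((*v) A ` cbox 0 b) = \<bar>det A\<bar> * measure lebesgue (cbox 0 b)"
  shows "scales_measure A"
proof -
  have "measure lebesgue ((*v) A ` cbox a b) = \<bar>det A\<bar> * measure lebesgue (cbox a b)" for a b
  proof (cases "cbox a b = {}")
    case False
    then have "0 \<le> (b - a) $ i" for i
      by (simp add: interval_ne_empty_cart)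
    moreover have "cbox a b = (+) a ` cbox 0 (b - a)"
      by (simp flip: cbox_translation)
    moreover have "(*v) A ` (+) a ` X = (+) (A *v a) ` (*v) A ` X" for X
      by (simp add: image_image matrix_vector_right_distrib)
    ultimately show ?thesis
      using box[of "b - a"] by (metis measure_translation)
  qed simp
  then show ?thesis
    unfolding scales_measure_def using measure_linear_sufficient[of "(*v) A" _ "\<bar>det A\<bar>"] by simp
qed

text \<open>
  The law is clear for products, singular matrices and diagonal matrices; coordinate swaps permute
  the sides of a box, and shears are volume preserving. The determinant of a shear comes from a row
  operation on the identity matrix, not from triangularity, since the index type has no order.
\<close>
lemma scales_measure: "scales_measure (A :: real ^ 'n ^ 'n::finite)"
proof (induction A rule: induct_matrix_elementary_alt)
  fix A B :: "real ^ 'n ^ 'n"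
  assume "scales_measure A" "scales_measure B"
  then show "scales_measure (A ** B)"
    by (simp add: scales_measure_def matrix_image_mult det_mul abs_mult)
next
  fix A :: "real ^ 'n ^ 'n" and i
  assume row: "row i A = 0"
  then have "det A = 0"
    by (rule det_zero_row)
  have "(*v) A ` S \<subseteq> {x. x $ i = 0}" for S
    using row by (auto simp: matrix_vector_mul_component row_def vec_lambda_eta)
  then have "negligible ((*v) A ` S)" for S
    using negligible_standard_hyperplane_cart negligible_subset by blast
  then show "scales_measure A"
    using \<open>det A = 0\<close> by (simp add: scales_measure_def negligible_iff_measure)
next
  fix A :: "real ^ 'n ^ 'n"
  assume diag: "\<And>i j. i \<noteq> j \<Longrightarrow> A $ i $ j = 0"
  have "A *v x = (\<chi> k. A $ k $ k * x $ k)" for x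
  proof -
    have "(\<Sum>j\<in>UNIV. A $ i $ j * x $ j) = (\<Sum>j\<in>UNIV. if j = i then A $ i $ i * x $ i else 0)" for i
      by (rule sum.cong) (use diag[of i] in auto)
    then show ?thesis
      by (simp add: matrix_vector_mult_def vec_eq_iff)
  qed
  then show "scales_measure A"
    using measurable_stretch[of _ "\<lambda>k. A $ k $ k"] measure_stretch[of _ "\<lambda>k. A $ k $ k"]
    by (simp add: scales_measure_def det_diagonal[OF diag])
next
  fix m n :: 'n
  define p where "p = Transposition.transpose m n"
  define A :: "real ^ 'n ^ 'n" where "A = (\<chi> i j. mat 1 $ i $ p j)"
  have p: "p permutes UNIV" "p (p i) = i" for i
    by (simp_all add: p_def permutes_swap_id)
  have "A *v x = (\<chi> i. x $ p i)" for x
  proof -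
    have "(\<Sum>j\<in>UNIV. A $ i $ j * x $ j) = (\<Sum>j\<in>UNIV. if j = p i then x $ p i else 0)" for i
      by (rule sum.cong) (use p(2) in \<open>auto simp: A_def mat_def\<close>)
    then show ?thesis
      by (simp add: matrix_vector_mult_def vec_eq_iff)
  qed
  moreover have "(\<lambda>x. \<chi> i. x $ p i) ` cbox 0 b = cbox 0 (\<chi> i. b $ p i)" (is "?f ` _ = _") for b :: "real ^ 'n"
  proof -
    have "y \<in> ?f ` cbox 0 b" if "y \<in> cbox 0 (?f b)" for y
    proof (rule image_eqI)
      show "y = ?f (?f y)"
        by (simp add: p(2) vec_eq_iff)
      show "?f y \<in> cbox 0 b"
        using that p(2) by (simp add: mem_box_cart) metis
    qed
    then show ?thesis
      by (auto simp: mem_box_cart)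
  qed
  ultimately have "(*v) A ` cbox 0 b = cbox 0 (\<chi> i. b $ p i)" for b
    by simp
  moreover have "measure lebesgue (cbox 0 (\<chi> i. b $ p i)) = measure lebesgue (cbox 0 b)"
    if "\<And>i. 0 \<le> b $ i" for b :: "real ^ 'n"
  proof -
    have "cbox 0 b \<noteq> {}" "cbox 0 (\<chi> i. b $ p i) \<noteq> {}"
      using that by (simp_all add: interval_ne_empty_cart)
    then show ?thesis
      using prod.permute[OF p(1), of "\<lambda>i. b $ i"] by (simp add: content_cbox_cart o_def)
  qed
  moreover have "\<bar>det A\<bar> = 1"
    using p(1) det_permute_columns[of p "mat 1 :: real ^ 'n ^ 'n"] by (simp add: A_def sign_def)
  ultimately have "scales_measure A"
    by (intro scales_measure_if_boxes) simp
  then show "scales_measure (\<chi> i j. mat 1 $ i $ Transposition.transpose m n j)"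
    by (simp add: A_def p_def)
next
  fix m n :: 'n assume "m \<noteq> n"
  define A :: "real ^ 'n ^ 'n" where "A = (\<chi> i j. of_bool (i = m \<and> j = n \<or> i = j))"
  have "A = (\<chi> k. if k = m then row m (mat 1) + 1 *s row n (mat 1) else row k (mat 1))"
    using \<open>m \<noteq> n\<close> by (auto simp: A_def vec_eq_iff row_def mat_def)
  then have "det A = 1"
    using det_row_operation[OF \<open>m \<noteq> n\<close>, of "mat 1" "1 :: real"] by simp
  have "A *v x = (\<chi> i. if i = m then x $ m + x $ n else x $ i)" for x
  proof -
    have "(\<Sum>j\<in>UNIV. A $ i $ j * x $ j) = (\<Sum>j\<in>UNIV. (if j = i then x $ i else 0) +
        (if j = n then if i = m then x $ n else 0 else 0))" for i
      by (rule sum.cong) (use \<open>m \<noteq> n\<close> in \<open>auto simp: A_def\<close>)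
    then show ?thesis
      by (simp add: matrix_vector_mult_def vec_eq_iff sum.distrib)
  qed
  then have "measure lebesgue ((*v) A ` cbox 0 b) = measure lebesgue (cbox 0 b)"
    if "\<And>i. 0 \<le> b $ i" for b
    using that measure_shear_interval[OF \<open>m \<noteq> n\<close>, of 0 b] by (simp add: interval_ne_empty_cart)
  then have "scales_measure A"
    using \<open>det A = 1\<close> by (intro scales_measure_if_boxes) simp
  then show "scales_measure (\<chi> i j. of_bool (i = m \<and> j = n \<or> i = j))"
    by (simp add: A_def)
qed

lemma measurable_matrix_image:
  fixes A :: "real ^ 'n ^ 'n::finite"
  shows "S \<in> lmeasurable \<Longrightarrow> (*v) A ` S \<in> lmeasurable"
  and measure_matrix_image:
    "S \<in> lmeasurable \<Longrightarrow> measure lebesgue ((*v) A ` S) = \<bar>det A\<bar> * measure lebesgue S"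
  using scales_measure[of A] by (auto simp: scales_measure_def)

section \<open>Volume and index of integer lattices\<close>

lemma det_real_mat: "det (real_mat Q) = of_int (det Q)"
  by (simp add: det_def real_mat_def)

lemma real_vec_mult: "real_vec (Q *v v) = real_mat Q *v real_vec v"
  by (simp add: real_vec_def real_mat_def matrix_vector_mult_def vec_eq_iff)

lemma real_vec_add: "real_vec (u + v) = real_vec u + real_vec v"
  by (simp add: real_vec_def vec_eq_iff)

lemma finite_bounded_integer_vectors:
  fixes X :: "(real ^ 'n::finite) set"
  assumes "bounded X"
  shows "finite {v. real_vec v \<in> X}"
proof -
  obtain b where b: "\<And>x. x \<in> X \<Longrightarrow> norm x \<le> b"
    using assms by (auto simp: bounded_iff)
  define F :: "(int ^ 'n \<Rightarrow> 'n \<Rightarrow> int)" where "F = vec_nth"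
  have "F v \<in> (\<Pi>\<^sub>E i\<in>UNIV. {- \<lfloor>b\<rfloor>..\<lfloor>b\<rfloor>})" if "real_vec v \<in> X" for v
  proof -
    have "\<bar>real_of_int (v $ i)\<bar> \<le> b" for i
      using component_le_norm_cart[of "real_vec v" i] b[OF that] by (simp add: real_vec_def)
    then have "\<bar>v $ i\<bar> \<le> \<lfloor>b\<rfloor>" for i
      by (simp add: le_floor_iff)
    then have "v $ i \<in> {- \<lfloor>b\<rfloor>..\<lfloor>b\<rfloor>}" for i
      by (simp add: abs_le_iff minus_le_iff)
    then show ?thesis
      by (auto simp: F_def)
  qed
  then have "F ` {v. real_vec v \<in> X} \<subseteq> (\<Pi>\<^sub>E i\<in>UNIV. {- \<lfloor>b\<rfloor>..\<lfloor>b\<rfloor>})"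
    by blast
  then have "finite (F ` {v. real_vec v \<in> X})"
    by (rule finite_subset) (intro finite_PiE; simp)
  moreover have "inj F"
    by (simp add: F_def inj_def vec_nth_inject)
  ultimately show ?thesis
    by (meson finite_imageD inj_on_subset subset_UNIV)
qed

text \<open>
  The unit cube \<open>P\<close> is cut into its pieces \<open>P \<inter> (v + G)\<close>; shifting each piece back by \<open>v\<close> moves it
  into \<open>G\<close>, and the shifted pieces stay disjoint because integer translates of the open cube are.
  Boundedness of \<open>G\<close> leaves only finitely many pieces.
\<close>
lemma measure_ge_1_if_integer_translates_cover:
  fixes G :: "(real ^ 'n::finite) set"
  assumes G: "G \<in> lmeasurable" "bounded G"
    and cover: "\<And>x. \<exists>v. x - real_vec v \<in> G"
  shows "measure lebesgue G \<ge> 1"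
proof -
  define P where "P = box (0 :: real ^ 'n) 1"
  define V where "V = {v. real_vec v \<in> (\<Union>x\<in>P. \<Union>y\<in>G. {x - y})}"
  have [simp]: "P \<in> lmeasurable"
    by (simp add: P_def)
  have unique: "u = v" if "x - real_vec u \<in> P" "x - real_vec v \<in> P" for x u v
  proof -
    have "0 < x $ i - real_of_int (u $ i) \<and> x $ i - real_of_int (u $ i) < 1 \<and>
          0 < x $ i - real_of_int (v $ i) \<and> x $ i - real_of_int (v $ i) < 1" for i
      using that by (auto simp: P_def mem_box_cart real_vec_def)
    then have "real_of_int \<bar>u $ i - v $ i\<bar> < real_of_int 1" for i
      by (smt (verit) of_int_1 of_int_abs of_int_diff)
    then have "\<bar>u $ i - v $ i\<bar> < 1" for i
      by (simp only: of_int_less_iff)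
    then have "u $ i = v $ i" for i
      by (simp add: zabs_less_one_iff)
    then show ?thesis
      by (simp add: vec_eq_iff)
  qed
  have "bounded P"
    by (simp add: P_def)
  then have fin: "finite V"
    unfolding V_def using \<open>bounded G\<close> by (intro finite_bounded_integer_vectors bounded_differences)
  have meas: "P \<inter> (+) (real_vec v) ` G \<in> lmeasurable"
    "(+) (- real_vec v) ` P \<inter> G \<in> lmeasurable" for v
    using G by (intro fmeasurable.Int measurable_translation; simp)+
  have "P = (\<Union>v\<in>V. P \<inter> (+) (real_vec v) ` G)"
  proof
    show "P \<subseteq> (\<Union>v\<in>V. P \<inter> (+) (real_vec v) ` G)"
    proof
      fix x assume "x \<in> P"
      obtain v where v: "x - real_vec v \<in> G"
        using cover by blast
      then have "v \<in> V"
        unfolding V_def using \<open>x \<in> P\<close>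
        by (intro CollectI UN_I[of x] UN_I[of "x - real_vec v"]) simp_all
      moreover have "x \<in> (+) (real_vec v) ` G"
        using v by (auto intro!: image_eqI[of _ _ "x - real_vec v"])
      ultimately show "x \<in> (\<Union>v\<in>V. P \<inter> (+) (real_vec v) ` G)"
        using \<open>x \<in> P\<close> by blast
    qed
  qed auto
  then have "measure lebesgue P \<le> (\<Sum>v\<in>V. measure lebesgue (P \<inter> (+) (real_vec v) ` G))"
    using measure_UNION_le[OF fin, of "\<lambda>v. P \<inter> (+) (real_vec v) ` G" lebesgue] meas(1)
    by (metis fmeasurableD)
  also have "\<dots> = (\<Sum>v\<in>V. measure lebesgue ((+) (- real_vec v) ` P \<inter> G))"
  proof (rule sum.cong)
    fix v
    have "(+) (- real_vec v) ` (P \<inter> (+) (real_vec v) ` G) = (+) (- real_vec v) ` P \<inter> G"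
      by (auto simp: image_Int image_image)
    then show "measure lebesgue (P \<inter> (+) (real_vec v) ` G) = measure lebesgue ((+) (- real_vec v) ` P \<inter> G)"
      by (metis measure_translation)
  qed simp
  also have "\<dots> = measure lebesgue (\<Union>v\<in>V. (+) (- real_vec v) ` P \<inter> G)"
  proof (rule measure_finite_Union[symmetric, OF fin])
    show "disjoint_family_on (\<lambda>v. (+) (- real_vec v) ` P \<inter> G) V"
      unfolding disjoint_family_on_def
    proof (intro ballI impI)
      fix u v :: "int ^ 'n" assume "u \<noteq> v"
      have "False" if x: "x \<in> (+) (- real_vec u) ` P" "x \<in> (+) (- real_vec v) ` P" for x
      proof -
        have "x + real_vec u \<in> P"
          using x(1) by auto
        moreover have "x + real_vec v \<in> P"
          using x(2) by auto
        ultimately show False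
          using unique[of "x + real_vec u + real_vec v" u v] \<open>u \<noteq> v\<close> by (simp add: algebra_simps)
      qed
      then show "(+) (- real_vec u) ` P \<inter> G \<inter> ((+) (- real_vec v) ` P \<inter> G) = {}"
        by blast
    qed
    show "(\<lambda>v. (+) (- real_vec v) ` P \<inter> G) ` V \<subseteq> sets lebesgue"
      using meas(2) by (auto intro: fmeasurableD)
    show "emeasure lebesgue ((+) (- real_vec v) ` P \<inter> G) \<noteq> \<infinity>" for v
      using fmeasurableD2[OF meas(2)[of v]] by (simp only: infinity_ennreal_def not_False_eq_True)
  qed
  also have "\<dots> \<le> measure lebesgue G"
    by (intro measure_mono_fmeasurable sets.finite_UN fin fmeasurableD[OF meas(2)] G(1)) blast
  finally have "measure lebesgue P \<le> measure lebesgue G" .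
  moreover have "measure lebesgue P = 1"
  proof -
    have "cbox 0 (1 :: real ^ 'n) \<noteq> {}"
      by (simp add: interval_ne_empty_cart)
    then have "measure lebesgue (cbox 0 (1 :: real ^ 'n)) = 1"
      by (simp add: content_cbox_cart)
    then show ?thesis
      by (simp add: P_def measure_lborel_box_eq measure_lborel_cbox_eq)
  qed
  ultimately show ?thesis by simp
qed

lemma invertible_real_mat:
  assumes "det Q \<noteq> 0"
  shows "real_mat Q *v (matrix_inv (real_mat Q) *v x) = x"
    and "matrix_inv (real_mat Q) *v (real_mat Q *v x) = x"
    and "det (matrix_inv (real_mat Q)) = inverse (of_int (det Q))"
proof -
  have "invertible (real_mat Q)"
    using assms by (simp add: invertible_det_nz det_real_mat)
  then have "real_mat Q ** matrix_inv (real_mat Q) = mat 1 \<and>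
             matrix_inv (real_mat Q) ** real_mat Q = mat 1"
    unfolding invertible_def matrix_inv_def by (rule someI_ex)
  then have inv: "real_mat Q ** matrix_inv (real_mat Q) = mat 1"
                 "matrix_inv (real_mat Q) ** real_mat Q = mat 1"
    by auto
  then show "real_mat Q *v (matrix_inv (real_mat Q) *v x) = x"
    "matrix_inv (real_mat Q) *v (real_mat Q *v x) = x"
    by (simp_all add: matrix_vector_mul_assoc)
  have "det (real_mat Q) * det (matrix_inv (real_mat Q)) = 1"
    using inv(1) by (metis det_I det_mul)
  then show "det (matrix_inv (real_mat Q)) = inverse (of_int (det Q))"
    using assms by (simp add: det_real_mat field_simps)
qed

lemma lattice_cover_elim:
  assumes "range ((*v) Q) + S = UNIV"
  obtains v s where "s \<in> S" "x = Q *v v + s"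
proof -
  have "x \<in> range ((*v) Q) + S"
    using assms by simp
  then show thesis
    using that by (auto elim!: set_plus_elim)
qed

text \<open>
  One half of the index formula \<open>[\<int>\<^sup>n : Q \<int>\<^sup>n] = |det Q|\<close>, by volume. The unit cubes at the
  points of \<open>C\<close> have total volume \<open>#C\<close> and their translates by \<open>Q \<int>\<^sup>n\<close> fill the space; applying
  \<open>Q\<^sup>-\<^sup>1\<close> gives a set of volume \<open>#C / |det Q|\<close> whose integer translates fill the space.
\<close>
lemma card_ge_abs_det_if_cover:
  fixes Q :: "int ^ 'n ^ 'n::finite"
  assumes det: "det Q \<noteq> 0" and fin: "finite C" and cover: "range ((*v) Q) + C = UNIV"
  shows "\<bar>det Q\<bar> \<le> int (card C)"
proof -
  define M where "M = matrix_inv (real_mat Q)"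
  define F where "F = (\<Union>c\<in>C. (+) (real_vec c) ` cbox 0 (1 :: real ^ 'n))"
  have F: "F \<in> lmeasurable" "bounded F"
    unfolding F_def using fin
    by (auto intro!: fmeasurable.finite_UN measurable_translation bounded_UN bounded_translation)
  have "\<exists>v. x - real_vec v \<in> (*v) M ` F" for x
  proof -
    define y where "y = real_mat Q *v x"
    define z :: "int ^ 'n" where "z = (\<chi> i. \<lfloor>y $ i\<rfloor>)"
    obtain v c where c: "c \<in> C" "z = Q *v v + c"
      using cover by (rule lattice_cover_elim)
    have "y - real_vec z \<in> cbox 0 1"
      by (auto simp: mem_box_cart z_def real_vec_def) linarith
    then have "real_vec c + (y - real_vec z) \<in> F"
      unfolding F_def using c(1) by blast
    moreover have "x - real_vec v = M *v (real_vec c + (y - real_vec z))"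
      using c(2) det unfolding M_def y_def
      by (simp add: real_vec_add real_vec_mult matrix_vector_mult_diff_distrib
          invertible_real_mat)
    ultimately show ?thesis
      by (metis imageI)
  qed
  then have "1 \<le> measure lebesgue ((*v) M ` F)"
    using F by (intro measure_ge_1_if_integer_translates_cover bounded_linear_image
        measurable_matrix_image) (auto simp: linear_linear)
  also have "\<dots> = \<bar>det M\<bar> * measure lebesgue F"
    using F by (simp add: measure_matrix_image)
  also have "measure lebesgue F \<le> (\<Sum>c\<in>C. measure lebesgue ((+) (real_vec c) ` cbox 0 (1 :: real ^ 'n)))"
    unfolding F_def using fin by (intro measure_UNION_le fmeasurableD measurable_translation) auto
  also have "\<dots> = real (card C)"
  proof -
    have "cbox 0 (1 :: real ^ 'n) \<noteq> {}"
      by (simp add: interval_ne_empty_cart)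
    then show ?thesis
      by (simp add: measure_translation content_cbox_cart)
  qed
  finally have "1 \<le> \<bar>det M\<bar> * real (card C)"
    by (simp add: mult_left_mono)
  then have "\<bar>real_of_int (det Q)\<bar> \<le> real (card C)"
    using det unfolding M_def by (simp add: invertible_real_mat field_simps)
  then show ?thesis
    by linarith
qed

section \<open>Skew-product form from an invariant periodic set\<close>

text \<open>
  Two congruent elements would allow one of them to be dropped from the cover, leaving fewer than
  \<open>|det Q|\<close> elements.
\<close>
lemma complete_residue_set_if_minimal_cover:
  fixes Q :: "int ^ 'n ^ 'n::finite"
  assumes det: "det Q \<noteq> 0" and fin: "finite S" and cover: "range ((*v) Q) + S = UNIV"
    and card: "int (card S) = \<bar>det Q\<bar>"
  shows "complete_residue_set Q S"
  unfolding complete_residue_set_def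
proof (intro allI ex_ex1I)
  fix x
  have neg: "Q *v (- v) = - (Q *v v)" for v
    using matrix_vector_right_distrib[of Q "- v" v] by (simp add: algebra_simps eq_neg_iff_add_eq_0)
  obtain v s where s: "s \<in> S" "x = Q *v v + s"
    using cover by (rule lattice_cover_elim)
  then have "s = x + Q *v (- v)"
    by (simp add: neg)
  then show "\<exists>s. s \<in> S \<and> s \<in> {x} + range ((*v) Q)"
    using s(1) by blast
  fix s t assume "s \<in> S \<and> s \<in> {x} + range ((*v) Q)" "t \<in> S \<and> t \<in> {x} + range ((*v) Q)"
  then obtain u v where st: "s \<in> S" "t \<in> S" "s = x + Q *v u" "t = x + Q *v v"
    by (auto elim!: set_plus_elim)
  show "s = t"
  proof (rule ccontr)
    assume "s \<noteq> t"
    have "y \<in> range ((*v) Q) + (S - {t})" for y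
    proof -
      obtain w r where r: "r \<in> S" "y = Q *v w + r"
        using cover by (rule lattice_cover_elim)
      show ?thesis
      proof (cases "r = t")
        case True
        then have "y = Q *v (w + v - u) + s"
          using r st by (simp add: matrix_vector_right_distrib matrix_vector_mult_diff_distrib)
        then show ?thesis
          using st(1) \<open>s \<noteq> t\<close> by blast
      next
        case False
        then show ?thesis using r by blast
      qed
    qed
    then have "\<bar>det Q\<bar> \<le> int (card (S - {t}))"
      using fin by (intro card_ge_abs_det_if_cover[OF det]) auto
    also have "\<dots> < int (card S)"
      using card_Diff1_less[OF fin st(2)] by (simp only: of_nat_less_iff)
    finally show False
      using card by simp
  qed
qed

lemma direct_sum_set_if_card:
  assumes "finite A" "finite B" "card A * card B \<le> card (A + B)"
  shows "direct_sum_set A B"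
  unfolding direct_sum_set_def
proof (rule eq_card_imp_inj_on)
  have "A + B = (\<lambda>(a, b). a + b) ` (A \<times> B)"
    by (rule set_plus_image)
  then show "card ((\<lambda>(a, b). a + b) ` (A \<times> B)) = card (A \<times> B)"
    using assms card_image_le[of "A \<times> B" "\<lambda>(a, b). a + b"] by (simp add: card_cartesian_product)
qed (use assms in simp)

lemma card_set_plus_le:
  assumes "finite A" "finite B"
  shows "card (A + B) \<le> card A * card B"
  unfolding set_plus_image using assms card_image_le[of "A \<times> B" "\<lambda>(a, b). a + b"]
  by (simp add: card_cartesian_product)

text \<open>
  For a fibre \<open>a\<^sub>j + Q B\<^sub>j\<close> of \<open>E\<close> and any \<open>z\<close>, the point \<open>a\<^sub>j + Q z\<close> of \<open>J = Q J + E\<close> has the form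
  \<open>Q y + a\<^sub>i + Q b\<close> with \<open>y \<in> J\<close> and \<open>b \<in> B\<^sub>i\<close>. Residues force \<open>i = j\<close>, so \<open>z = y + b\<close>, which lies in
  \<open>Q \<int>\<^sup>n + A + B\<^sub>j\<close>. Hence every \<open>s #B\<^sub>j\<close> is at least \<open>|det Q|\<close>, while their sum over the \<open>s\<close>
  indices is \<open>s #E = s |det Q|\<close>; so all are equal to \<open>|det Q|\<close>.
\<close>
lemma skew_product_form_if_invariant:
  fixes Q :: "int ^ 'n ^ 'n::finite"
  assumes det: "det Q \<noteq> 0" and fin: "finite E" and card: "int (card E) = \<bar>det Q\<bar>"
    and J: "J = range ((*v) Q) + E" and eq: "J = (*v) Q ` J + E"
  shows "skew_product_form Q E"
proof -
  have inj: "u = v" if "Q *v u = Q *v v" for u v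
  proof -
    have "real_mat Q *v real_vec u = real_mat Q *v real_vec v"
      using that by (simp flip: real_vec_mult)
    then have "real_vec u = real_vec v"
      by (metis det invertible_real_mat(2))
    then show ?thesis
      by (simp add: real_vec_def vec_eq_iff)
  qed
  \<comment> \<open>\<open>r\<close> picks a representative in \<open>E\<close> that depends on the residue class only, so \<open>A = r ` E\<close> below
    meets each class of \<open>E\<close> exactly once.\<close>
  define r where "r e = (SOME a. a \<in> E \<and> e - a \<in> range ((*v) Q))" for e
  have r: "r e \<in> E" "e - r e \<in> range ((*v) Q)" if "e \<in> E" for e
  proof -
    have "e - e = Q *v 0"
      by simp
    then have "\<exists>a. a \<in> E \<and> e - a \<in> range ((*v) Q)"
      using that by blast
    then have "r e \<in> E \<and> e - r e \<in> range ((*v) Q)"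
      unfolding r_def by (rule someI_ex)
    then show "r e \<in> E" "e - r e \<in> range ((*v) Q)"
      by auto
  qed
  have r_cong: "r e = r e'" if cong: "e - e' \<in> range ((*v) Q)" for e e'
  proof -
    obtain u where "e - e' = Q *v u"
      using cong by blast
    then have u: "e = e' + Q *v u"
      by (simp add: diff_eq_eq add.commute)
    have "(e - a \<in> range ((*v) Q)) = (e' - a \<in> range ((*v) Q))" for a
    proof
      assume "e - a \<in> range ((*v) Q)"
      then obtain v where "e - a = Q *v v" by blast
      then have "e' - a = Q *v (v - u)"
        using u by (simp add: matrix_vector_mult_diff_distrib algebra_simps)
      then show "e' - a \<in> range ((*v) Q)" by blast
    next
      assume "e' - a \<in> range ((*v) Q)"
      then obtain v where "e' - a = Q *v v" by blast
      then have "e - a = Q *v (v + u)"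
        using u by (simp add: matrix_vector_right_distrib algebra_simps)
      then show "e - a \<in> range ((*v) Q)" by blast
    qed
    then show ?thesis
      by (simp add: r_def)
  qed
  define A where "A = r ` E"
  have finA: "finite A" and A_sub: "A \<subseteq> E"
    using fin r by (auto simp: A_def)
  have r_A: "r a = a" if a: "a \<in> A" for a
  proof -
    obtain e where "e \<in> E" "a = r e"
      using a by (auto simp: A_def)
    then show ?thesis
      using r_cong[OF r(2)] by metis
  qed
  obtain a where a: "bij_betw a {..<card A} A"
    using ex_bij_betw_nat_finite[OF finA] by (auto simp: atLeast0LessThan)
  define s where "s = card A"
  have inj_a: "inj_on a {..<s}" and im_a: "a ` {..<s} = A"
    using a by (auto simp: bij_betw_def s_def)
  define B where "B j = {b. a j + Q *v b \<in> E}" for j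
  have incong: "i = j" if "i < s" "j < s" "a i + Q *v u = a j + Q *v v" for i j u v
  proof -
    have "a i - a j = Q *v (v - u)"
      using that(3) by (simp add: matrix_vector_mult_diff_distrib algebra_simps)
    then have "r (a i) = r (a j)"
      by (intro r_cong) simp
    then have "a i = a j"
      using r_A im_a that by auto
    then show ?thesis
      using inj_a that by (auto simp: inj_on_def)
  qed
  have decomp: "\<exists>j<s. \<exists>b\<in>B j. e = a j + Q *v b" if e: "e \<in> E" for e
  proof -
    have "r e \<in> A"
      using e by (simp add: A_def)
    then obtain j where j: "j < s" "r e = a j"
      unfolding im_a[symmetric] by blast
    obtain b where "e - a j = Q *v b"
      using r(2)[OF e] j by auto
    then have "e = a j + Q *v b"
      by (simp add: algebra_simps)
    then show ?thesis
      using j e by (auto simp: B_def)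
  qed
  have E_eq: "E = (\<Union>j<s. {a j} + (*v) Q ` B j)"
  proof
    show "E \<subseteq> (\<Union>j<s. {a j} + (*v) Q ` B j)"
      using decomp by fastforce
    show "(\<Union>j<s. {a j} + (*v) Q ` B j) \<subseteq> E"
      by (auto simp: B_def elim!: set_plus_elim)
  qed
  have finB: "finite (B j)" for j
  proof (rule inj_on_finite)
    show "inj_on (\<lambda>b. a j + Q *v b) (B j)"
      by (auto simp: inj_on_def dest: inj)
  qed (use fin in \<open>auto simp: B_def\<close>)
  have "card E = (\<Sum>j<s. card ({a j} + (*v) Q ` B j))"
    unfolding E_eq by (rule card_UN_disjoint)
      (auto simp: finB finite_set_plus elim!: set_plus_elim dest: incong)
  also have "\<dots> = (\<Sum>j<s. card (B j))"
  proof (rule sum.cong)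
    fix j
    have "{a j} + (*v) Q ` B j = (\<lambda>b. a j + Q *v b) ` B j"
      by (auto simp: set_plus_def)
    moreover have "inj_on (\<lambda>b. a j + Q *v b) (B j)"
      by (auto simp: inj_on_def dest: inj)
    ultimately show "card ({a j} + (*v) Q ` B j) = card (B j)"
      by (simp add: card_image)
  qed simp
  finally have card_E: "card E = (\<Sum>j<s. card (B j))" .
  have cover: "range ((*v) Q) + (A + B j) = UNIV" if "j < s" for j
  proof -
    have "z \<in> range ((*v) Q) + (A + B j)" for z
    proof -
      have "a j \<in> E"
        using that im_a A_sub by blast
      then have "Q *v z + a j \<in> J"
        unfolding J by blast
      then have "Q *v z + a j \<in> (*v) Q ` J + E"
        using eq by simp
      then obtain y e where y: "y \<in> J" and e: "e \<in> E" and ye: "Q *v z + a j = Q *v y + e"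
        by (auto elim!: set_plus_elim)
      obtain i b where i: "i < s" "b \<in> B i" "e = a i + Q *v b"
        using decomp[OF e] by blast
      have eq2: "a j + Q *v z = a i + Q *v (y + b)"
        using ye i by (simp add: matrix_vector_right_distrib algebra_simps)
      then have "i = j"
        using incong i that by metis
      then have z: "z = y + b"
        using eq2 inj by simp
      obtain v e' where e': "e' \<in> E" "y = Q *v v + e'"
        using y unfolding J by (auto elim!: set_plus_elim)
      obtain w where w: "e' - r e' = Q *v w"
        using r(2)[OF e'(1)] by blast
      have "z = Q *v (v + w) + (r e' + b)"
        using z e' w by (simp add: matrix_vector_right_distrib algebra_simps)
      moreover have "r e' + b \<in> A + B j"
        using e' i \<open>i = j\<close> by (auto simp: A_def)
      ultimately show ?thesis
        by blast
    qed
    then show ?thesis by blast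
  qed
  have finAB: "finite (A + B j)" for j
    using finA finB by (rule finite_set_plus)
  have low: "\<bar>det Q\<bar> \<le> int (card (A + B j))" if "j < s" for j
    using card_ge_abs_det_if_cover[OF det finAB cover[OF that]] .
  have le: "card (A + B j) \<le> s * card (B j)" for j
    using card_set_plus_le[OF finA finB] by (simp add: s_def)
  have tight: "int (s * card (B j)) = \<bar>det Q\<bar>" if "j < s" for j
  proof (rule ccontr)
    assume ne: "int (s * card (B j)) \<noteq> \<bar>det Q\<bar>"
    have ge: "card E \<le> s * card (B i)" if "i < s" for i
      using low[OF that] le[of i] card by linarith
    have "(\<Sum>i<s. card E) < (\<Sum>i<s. s * card (B i))"
    proof (rule sum_strict_mono_ex1)
      show "\<exists>i\<in>{..<s}. card E < s * card (B i)"
      proof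
        show "card E < s * card (B j)"
          using ge[OF that] ne card by linarith
      qed (use that in simp)
    qed (use ge in auto)
    then show False
      by (simp add: card_E flip: sum_distrib_left)
  qed
  have "direct_sum_set A (B j) \<and> complete_residue_set Q (A + B j)" if "j < s" for j
  proof
    have "int (card (A + B j)) = \<bar>det Q\<bar>" "card A * card (B j) \<le> card (A + B j)"
      using low[OF that] le[of j] tight[OF that] unfolding s_def by linarith+
    then show "direct_sum_set A (B j)" "complete_residue_set Q (A + B j)"
      using direct_sum_set_if_card[OF finA finB]
        complete_residue_set_if_minimal_cover[OF det finAB cover[OF that]] by auto
  qed
  then show ?thesis
    unfolding skew_product_form_def using fin card E_eq inj_a
    by (intro conjI exI[of _ s] exI[of _ a] exI[of _ B]) (simp_all add: im_a)
qed

section \<open>Powers of the inverse of an expanding matrix\<close>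

text \<open>
  The vector \<open>p(A) v\<close>, written in Horner form so that no powers of the matrix \<open>A\<close> are needed.
\<close>
definition poly_action :: "complex ^ 'n ^ 'n \<Rightarrow> complex poly \<Rightarrow> complex ^ 'n::finite \<Rightarrow> complex ^ 'n" where
  "poly_action A p v = fold_coeffs (\<lambda>a w. a *s v + A *v w) p 0"

lemma poly_action_0 [simp]: "poly_action A 0 v = 0"
  by (simp add: poly_action_def)

lemma poly_action_pCons [simp]: "poly_action A (pCons a p) v = a *s v + A *v poly_action A p v"
  by (cases "a = 0 \<and> p = 0") (auto simp: poly_action_def)

lemma poly_action_add: "poly_action A (p + q) v = poly_action A p v + poly_action A q v"
  by (induction p q rule: poly_induct2)
     (simp_all add: matrix_vector_right_distrib vec.scale_left_distrib)

lemma poly_action_smult: "poly_action A (smult c p) v = c *s poly_action A p v"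
  by (induction p) (simp_all add: vec.scale_right_distrib vector_scalar_commute)

lemma poly_action_monom: "poly_action A (monom c k) v = c *s ((*v) A ^^ k) v"
  by (induction k) (simp_all add: monom_0 monom_Suc vector_scalar_commute)

lemma poly_action_sum: "poly_action A (sum p I) v = (\<Sum>i\<in>I. poly_action A (p i) v)"
  by (induction I rule: infinite_finite_induct) (simp_all add: poly_action_add)

lemma poly_action_shift:
  "poly_action A p (A *v v - c *s v) = A *v poly_action A p v - c *s poly_action A p v"
  by (induction p)
     (simp_all add: matrix_vector_right_distrib matrix_vector_mult_diff_distrib
       vec.scale_right_diff_distrib vec.scale_right_distrib vector_scalar_commute mult.commute)

text \<open>
  The \<open>n + 1\<close> vectors \<open>v, A v, \<dots>, A\<^sup>n v\<close> are linearly dependent, or two of them coincide.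
\<close>
lemma annihilating_poly_exists:
  fixes A :: "complex ^ 'n ^ 'n::finite"
  shows "\<exists>p. p \<noteq> 0 \<and> poly_action A p v = 0"
proof (cases "inj_on (\<lambda>k. ((*v) A ^^ k) v) {..CARD('n)}")
  let ?x = "\<lambda>k. ((*v) A ^^ k) v"
  case True
  let ?S = "?x ` {..CARD('n)}"
  have "card ?S = CARD('n) + 1"
    using True by (simp add: card_image)
  then have "vec.dependent ?S"
    using vec.independent_card_le_dim[of ?S UNIV] vec_dim_card[where ?'a = complex and ?'n = 'n]
    by auto
  then obtain u k where u: "k \<le> CARD('n)" "u (?x k) \<noteq> 0" "(\<Sum>w\<in>?S. u w *s w) = 0"
    by (auto simp: vec.dependent_finite)
  define p where "p = (\<Sum>i\<le>CARD('n). monom (u (?x i)) i)"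
  have "coeff p k = u (?x k)"
    using u(1) by (simp add: p_def coeff_sum sum.delta)
  then have "p \<noteq> 0"
    using u(2) by auto
  moreover have "poly_action A p v = 0"
    using u(3) True by (simp add: p_def poly_action_sum poly_action_monom sum.reindex)
  ultimately show ?thesis by blast
next
  case False
  then obtain i j where ij: "i \<noteq> j" "((*v) A ^^ i) v = ((*v) A ^^ j) v"
    by (auto simp: inj_on_def)
  define p where "p = monom (1 :: complex) i + smult (- 1) (monom 1 j)"
  have "coeff p i = 1"
    using ij(1) by (simp add: p_def)
  then have "p \<noteq> 0"
    by auto
  moreover have "poly_action A p v = 0"
    using ij(2) by (simp add: p_def poly_action_add poly_action_smult poly_action_monom del: smult_minus_left)
  ultimately show ?thesis by blast
qed

text \<open>
  Once \<open>e\<^sub>k < c (1 - r)\<close>, the excess of \<open>a\<^sub>k\<close> over \<open>c\<close> shrinks by the factor \<open>r\<close> in each step.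
\<close>
lemma perturbed_contraction_tendsto_0:
  fixes a e :: "nat \<Rightarrow> real"
  assumes r: "0 \<le> r" "r < 1" and a: "\<And>k. 0 \<le> a k" and e: "e \<longlonglongrightarrow> 0"
    and step: "\<And>k. a (Suc k) \<le> r * a k + e k"
  shows "a \<longlonglongrightarrow> 0"
proof (rule LIMSEQ_I)
  fix d :: real assume "d > 0"
  define c where "c = d / 2"
  have "c > 0" using \<open>d > 0\<close> by (simp add: c_def)
  then have "eventually (\<lambda>k. e k < c * (1 - r)) sequentially"
    using e r by (intro order_tendstoD) auto
  then obtain N where N: "\<And>k. k \<ge> N \<Longrightarrow> e k < c * (1 - r)"
    by (auto simp: eventually_sequentially)
  have bound: "a (N + j) \<le> r ^ j * a N + c" for j
  proof (induction j)
    case (Suc j)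
    have "a (N + Suc j) \<le> r * a (N + j) + c * (1 - r)"
      using step[of "N + j"] N[of "N + j"] by simp
    also have "\<dots> \<le> r * (r ^ j * a N + c) + c * (1 - r)"
      using Suc r by (intro add_right_mono mult_left_mono) auto
    finally show ?case by (simp add: algebra_simps)
  qed (use \<open>c > 0\<close> in simp)
  have "(\<lambda>j. r ^ j * a N) \<longlonglongrightarrow> 0 * a N"
    using r by (intro tendsto_mult tendsto_const LIMSEQ_power_zero) auto
  then have "eventually (\<lambda>j. r ^ j * a N < c) sequentially"
    using \<open>c > 0\<close> by (intro order_tendstoD) auto
  then obtain M where M: "\<And>j. j \<ge> M \<Longrightarrow> r ^ j * a N < c"
    by (auto simp: eventually_sequentially)
  show "\<exists>no. \<forall>n\<ge>no. norm (a n - 0) < d"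
  proof (intro exI allI impI)
    fix n assume "n \<ge> N + M"
    then have "a n < d"
      using bound[of "n - N"] M[of "n - N"] by (fastforce simp: c_def)
    then show "norm (a n - 0) < d"
      using a[of n] by simp
  qed
qed

lemma norm_vector_smult: "norm (c *s (x :: complex ^ 'n::finite)) = cmod c * norm x"
  by (simp add: norm_vec_def L2_set_def norm_mult power_mult_distrib real_sqrt_mult
      flip: sum_distrib_left)

text \<open>
  Induction on the degree of \<open>p = (X - c) q\<close>. The vector \<open>y = q(A) v\<close> satisfies \<open>A y = c y\<close>. Either
  \<open>y = 0\<close>, and \<open>q\<close> already annihilates \<open>v\<close>, or \<open>c\<close> is an eigenvalue, so \<open>|c| < 1\<close>. In the second case
  \<open>q\<close> annihilates \<open>w = A v - c v\<close>, and \<open>A\<^sup>k\<^sup>+\<^sup>1 v = c A\<^sup>k v + A\<^sup>k w\<close> is a contraction perturbed by a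
  sequence that tends to \<open>0\<close>.
\<close>
lemma iterates_tendsto_0_if_annihilated:
  fixes A :: "complex ^ 'n::finite ^ 'n"
  assumes eigen: "\<And>c v. v \<noteq> 0 \<Longrightarrow> A *v v = c *s v \<Longrightarrow> cmod c < 1"
  shows "p \<noteq> 0 \<Longrightarrow> poly_action A p v = 0 \<Longrightarrow> (\<lambda>k. ((*v) A ^^ k) v) \<longlonglongrightarrow> 0"
proof (induction "degree p" arbitrary: p v)
  case 0
  then obtain a where "p = [:a:]"
    by (metis degree_eq_zeroE)
  then have "v = 0"
    using 0 by simp
  moreover have "((*v) A ^^ k) 0 = 0" for k
    by (induction k) simp_all
  ultimately show ?case
    by simp
next
  case (Suc n)
  then have "\<not> constant (poly p)"
    by (simp add: constant_degree)
  then obtain c where "poly p c = 0"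
    using fundamental_theorem_of_algebra by blast
  then obtain q where q: "p = [:- c, 1:] * q"
    by (auto simp: poly_eq_0_iff_dvd elim: dvdE)
  have "q \<noteq> 0"
    using q \<open>p \<noteq> 0\<close> by auto
  then have "degree q = n"
    using q Suc.hyps(2) by (simp add: degree_mult_eq del: mult_pCons_left)
  define y where "y = poly_action A q v"
  have "A *v y = c *s y"
    using Suc.prems(2) unfolding q y_def
    by (simp add: poly_action_add poly_action_smult vec.scale_minus_left del: smult_minus_left)
  show ?case
  proof (cases "y = 0")
    case True
    then show ?thesis
      using Suc.hyps(1)[of q v] \<open>q \<noteq> 0\<close> \<open>degree q = n\<close> by (simp add: y_def)
  next
    case False
    then have c: "cmod c < 1"
      using eigen \<open>A *v y = c *s y\<close> by blast
    define w where "w = A *v v - c *s v"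
    have "poly_action A q w = 0"
      using \<open>A *v y = c *s y\<close> by (simp add: w_def poly_action_shift y_def)
    then have w: "(\<lambda>k. ((*v) A ^^ k) w) \<longlonglongrightarrow> 0"
      using Suc.hyps(1)[of q w] \<open>q \<noteq> 0\<close> \<open>degree q = n\<close> by simp
    have step: "((*v) A ^^ Suc k) v = c *s ((*v) A ^^ k) v + ((*v) A ^^ k) w" for k
      by (induction k)
         (simp_all add: w_def matrix_vector_right_distrib vector_scalar_commute)
    have "(\<lambda>k. norm (((*v) A ^^ k) v)) \<longlonglongrightarrow> 0"
    proof (rule perturbed_contraction_tendsto_0[OF _ c])
      show "(\<lambda>k. norm (((*v) A ^^ k) w)) \<longlonglongrightarrow> 0"
        using w by (simp add: tendsto_norm_zero)
      show "norm (((*v) A ^^ Suc k) v) \<le> cmod c * norm (((*v) A ^^ k) v) + norm (((*v) A ^^ k) w)" for k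
        unfolding step by (metis norm_triangle_ineq norm_vector_smult)
    qed auto
    then show ?thesis
      by (rule tendsto_norm_zero_cancel)
  qed
qed

definition complex_vec :: "real ^ 'n \<Rightarrow> complex ^ 'n::finite" where
  "complex_vec x = (\<chi> i. complex_of_real (x $ i))"

lemma norm_complex_vec: "norm (complex_vec x) = norm x"
  by (simp add: norm_vec_def complex_vec_def)

lemma complex_vec_mult:
  "complex_vec (A *v x) = map_matrix complex_of_real A *v complex_vec x"
  by (simp add: complex_vec_def matrix_vector_mult_def vec_eq_iff)

lemma map_matrix_of_real_mult:
  fixes A B :: "real ^ 'n ^ 'n::finite"
  shows "map_matrix complex_of_real (A ** B) =
    map_matrix complex_of_real A ** map_matrix complex_of_real B"
  by (simp add: matrix_matrix_mult_def vec_eq_iff)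

text \<open>
  The eigenvalues of the complexified inverse are the inverses of those of \<open>R\<close>.
\<close>
lemma iterates_tendsto_0_if_inverse_expanding:
  fixes M :: "real ^ 'n ^ 'n::finite"
  assumes "expanding R" and inv: "real_mat R ** M = mat 1"
  shows "(\<lambda>k. ((*v) M ^^ k) x) \<longlonglongrightarrow> 0"
proof -
  define N where "N = map_matrix complex_of_real M"
  have "complex_mat R = map_matrix complex_of_real (real_mat R)"
    by (simp add: complex_mat_def real_mat_def vec_eq_iff)
  then have "complex_mat R ** N = mat 1"
    unfolding N_def by (simp add: inv flip: map_matrix_of_real_mult) (simp add: mat_def vec_eq_iff)
  then have inv_N: "complex_mat R *v (N *v v) = v" for v
    by (simp add: matrix_vector_mul_assoc)
  have eigen: "cmod c < 1" if v: "v \<noteq> 0" "N *v v = c *s v" for c v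
  proof -
    have Rv: "v = c *s (complex_mat R *v v)"
      using inv_N[of v] v by (simp add: vector_scalar_commute)
    then have "c \<noteq> 0"
      using v(1) by auto
    then have "complex_mat R *v v = inverse c *s v"
      using Rv by (metis left_inverse vector_smult_assoc vector_smult_lid)
    then have "cmod (inverse c) > 1"
      using \<open>expanding R\<close> v(1) unfolding expanding_def by blast
    then show ?thesis
      using \<open>c \<noteq> 0\<close> by (simp add: norm_inverse one_less_inverse_iff)
  qed
  have "complex_vec (((*v) M ^^ k) x) = ((*v) N ^^ k) (complex_vec x)" for k
    by (induction k) (simp_all add: complex_vec_mult N_def)
  then have norm_eq: "norm (((*v) M ^^ k) x) = norm (((*v) N ^^ k) (complex_vec x))" for k
    by (metis norm_complex_vec)
  have "(\<lambda>k. ((*v) N ^^ k) (complex_vec x)) \<longlonglongrightarrow> 0"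
    using annihilating_poly_exists[of N "complex_vec x"]
      iterates_tendsto_0_if_annihilated[of N] eigen by metis
  then have "(\<lambda>k. norm (((*v) M ^^ k) x)) \<longlonglongrightarrow> 0"
    unfolding norm_eq by (rule tendsto_norm_zero)
  then show ?thesis
    by (rule tendsto_norm_zero_cancel)
qed

lemma funpow_linear:
  fixes f :: "'a::real_vector \<Rightarrow> 'a"
  shows "linear f \<Longrightarrow> linear (f ^^ k)"
proof (induction k)
  case (Suc k)
  then show ?case
    using linear_compose[of "f ^^ k" f] by (simp add: o_def)
qed (simp add: id_def linear_ident)

text \<open>
  Expanding \<open>x\<close> in the standard basis turns pointwise convergence into convergence in operator
  norm.
\<close>
lemma iterates_uniformly_tendsto_0:
  fixes f :: "'a::euclidean_space \<Rightarrow> 'a"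
  assumes "linear f" and lim: "\<And>x. (\<lambda>k. (f ^^ k) x) \<longlonglongrightarrow> 0"
  obtains C where "C \<longlonglongrightarrow> 0" and "\<And>k x. norm ((f ^^ k) x) \<le> C k * norm x"
proof
  show "(\<lambda>k. \<Sum>b\<in>Basis. norm ((f ^^ k) b)) \<longlonglongrightarrow> 0"
    by (intro tendsto_null_sum tendsto_norm_zero lim)
  fix k x
  interpret linear "f ^^ k"
    using \<open>linear f\<close> by (rule funpow_linear)
  have "(f ^^ k) x = (f ^^ k) (\<Sum>b\<in>Basis. (x \<bullet> b) *\<^sub>R b)"
    by (simp add: euclidean_representation)
  also have "\<dots> = (\<Sum>b\<in>Basis. (x \<bullet> b) *\<^sub>R (f ^^ k) b)"
    by (simp add: sum scale)
  also have "norm \<dots> \<le> (\<Sum>b\<in>Basis. norm x * norm ((f ^^ k) b))"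
    by (intro sum_norm_le) (simp add: Basis_le_norm mult_right_mono)
  finally show "norm ((f ^^ k) x) \<le> (\<Sum>b\<in>Basis. norm ((f ^^ k) b)) * norm x"
    by (simp add: sum_distrib_left mult.commute)
qed

section \<open>The attractor of the digit maps\<close>

text \<open>
  The Hutchinson operator of the iterated function system \<open>x \<mapsto> f (x + e)\<close>, \<open>e \<in> E\<close>. For \<open>f = R\<^sup>-\<^sup>1\<close>
  and \<open>E = D\<close> its fixed point is the set \<open>T(R, D)\<close>.
\<close>
definition hutchinson :: "('a::real_vector \<Rightarrow> 'a) \<Rightarrow> 'a set \<Rightarrow> 'a set \<Rightarrow> 'a set" where
  "hutchinson f E X = (\<Union>e\<in>E. (\<lambda>x. f (x + e)) ` X)"

lemma hutchinson_mono: "X \<subseteq> Y \<Longrightarrow> hutchinson f E X \<subseteq> hutchinson f E Y"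
  unfolding hutchinson_def by blast

lemma hutchinson_I: "x \<in> X \<Longrightarrow> e \<in> E \<Longrightarrow> f (x + e) \<in> hutchinson f E X"
  unfolding hutchinson_def by blast

lemma hutchinson_E:
  assumes "x \<in> hutchinson f E X"
  obtains y e where "y \<in> X" "e \<in> E" "x = f (y + e)"
  using assms unfolding hutchinson_def by blast

lemma compact_hutchinson:
  fixes f :: "'a::euclidean_space \<Rightarrow> 'a"
  assumes "linear f" "finite E" "compact X"
  shows "compact (hutchinson f E X)"
proof -
  have "continuous_on X (\<lambda>x. f (x + e))" for e
    by (rule linear_continuous_on_compose[OF _ \<open>linear f\<close>]) (intro continuous_intros)
  then show ?thesis
    unfolding hutchinson_def using assms(2,3) by (intro compact_UN compact_continuous_image)
qed

text \<open>
  Trace a point of \<open>T\<close> back through \<open>k\<close> steps to some \<open>t \<in> T\<close> and follow the same digits forward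
  from some \<open>u \<in> U\<close>. The two results differ by \<open>f\<^sup>k (t - u)\<close>, which tends to \<open>0\<close>; so each point of \<open>T\<close> is a limit of points of \<open>U\<close>.
\<close>
lemma hutchinson_fixed_points_le:
  fixes f :: "'a::euclidean_space \<Rightarrow> 'a"
  assumes f: "linear f" and lim: "\<And>x. (\<lambda>k. (f ^^ k) x) \<longlonglongrightarrow> 0"
    and T: "bounded T" "T \<subseteq> hutchinson f E T"
    and U: "compact U" "U \<noteq> {}" "hutchinson f E U \<subseteq> U"
  shows "T \<subseteq> U"
proof
  fix x assume "x \<in> T"
  obtain C where C: "C \<longlonglongrightarrow> 0" "\<And>k x. norm ((f ^^ k) x) \<le> C k * norm x"
    using iterates_uniformly_tendsto_0[OF f lim] by blast
  obtain b where b: "\<And>t u. t \<in> T \<Longrightarrow> u \<in> U \<Longrightarrow> norm (t - u) \<le> b"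
    using bounded_differences[OF \<open>bounded T\<close> compact_imp_bounded[OF U(1)]]
    by (auto simp: bounded_iff)
  have approx: "\<exists>y\<in>U. \<exists>t\<in>T. \<exists>u\<in>U. z - y = (f ^^ k) (t - u)" if "z \<in> T" for z k
    using that
  proof (induction k arbitrary: z)
    case 0
    then show ?case
      using \<open>U \<noteq> {}\<close> by fastforce
  next
    case (Suc k)
    then obtain z' e where z': "z' \<in> T" "e \<in> E" "z = f (z' + e)"
      using T(2) by (blast elim: hutchinson_E)
    then obtain y t u where y: "y \<in> U" "t \<in> T" "u \<in> U" "z' - y = (f ^^ k) (t - u)"
      using Suc.IH by blast
    have "f (y + e) \<in> U"
      using U(3) hutchinson_I[OF y(1) z'(2)] by blast
    moreover have "z - f (y + e) = f (z' - y)"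
      using f z'(3) by (simp add: linear_diff linear_add)
    ultimately show ?case
      using y by (metis comp_apply funpow.simps(2))
  qed
  have "\<exists>y\<in>U. dist y x < d" if "d > 0" for d
  proof -
    have "(\<lambda>k. \<bar>C k\<bar> * b) \<longlonglongrightarrow> 0 * b"
      by (intro tendsto_mult tendsto_rabs_zero C tendsto_const)
    then have "eventually (\<lambda>k. \<bar>C k\<bar> * b < d) sequentially"
      using \<open>d > 0\<close> by (intro order_tendstoD) auto
    then obtain k where k: "\<bar>C k\<bar> * b < d"
      by (auto simp: eventually_sequentially)
    obtain y t u where y: "y \<in> U" "t \<in> T" "u \<in> U" "x - y = (f ^^ k) (t - u)"
      using approx[OF \<open>x \<in> T\<close>] by blast
    have "dist y x = norm ((f ^^ k) (t - u))"
      using y(4) by (simp add: dist_norm norm_minus_commute)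
    also have "\<dots> \<le> C k * norm (t - u)"
      by (rule C)
    also have "\<dots> \<le> \<bar>C k\<bar> * b"
      using b[OF y(2,3)] by (intro mult_mono) auto
    also have "\<dots> < d"
      by (rule k)
    finally show ?thesis
      using y(1) by blast
  qed
  then show "x \<in> U"
    using closed_approachable[OF compact_imp_closed[OF U(1)]] by blast
qed

text \<open>
  The map \<open>f\<close> itself need not be a contraction, but some power \<open>f\<^sup>k\<close> halves norms. The \<open>k\<close>-th power
  of the operator differs from \<open>f\<^sup>k\<close> by a bounded error and so maps a large ball \<open>B\<close> into itself;
  then the union of \<open>B\<close> and its first \<open>k - 1\<close> images is invariant, where \<open>k > 0\<close> keeps \<open>B\<close> in
  the union.
\<close>
lemma invariant_compact_exists:
  fixes f :: "'a::euclidean_space \<Rightarrow> 'a"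
  assumes f: "linear f" and lim: "\<And>x. (\<lambda>k. (f ^^ k) x) \<longlonglongrightarrow> 0"
    and E: "finite E" "E \<noteq> {}"
  obtains K where "compact K" "K \<noteq> {}" "hutchinson f E K \<subseteq> K"
proof -
  let ?H = "hutchinson f E"
  obtain C where C: "C \<longlonglongrightarrow> 0" "\<And>k x. norm ((f ^^ k) x) \<le> C k * norm x"
    using iterates_uniformly_tendsto_0[OF f lim] by blast
  have "eventually (\<lambda>k. C k < 1 / 2) sequentially"
    using C(1) by (intro order_tendstoD) auto
  then obtain N where "\<And>n. n \<ge> N \<Longrightarrow> C n < 1 / 2"
    by (auto simp: eventually_sequentially)
  then obtain k where k: "C k < 1 / 2" "k > 0"
    by (metis le_SucI order_refl zero_less_Suc)
  have approx: "\<exists>b. \<forall>X. \<forall>x\<in>(?H ^^ j) X. \<exists>y\<in>X. norm (x - (f ^^ j) y) \<le> b" for j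
  proof (induction j)
    case 0
    show ?case by (auto intro!: exI[of _ 0])
  next
    case (Suc j)
    then obtain b where b: "\<And>X x. x \<in> (?H ^^ j) X \<Longrightarrow> \<exists>y\<in>X. norm (x - (f ^^ j) y) \<le> b"
      by blast
    obtain B where B: "\<And>x. norm (f x) \<le> B * norm x" "B > 0"
      using linear_bounded_pos[OF f] by blast
    define c where "c = Max (norm ` E)"
    have "\<exists>y\<in>X. norm (x - (f ^^ Suc j) y) \<le> B * (b + c)" if x: "x \<in> (?H ^^ Suc j) X" for X x
    proof -
      obtain z e where z: "z \<in> (?H ^^ j) X" "e \<in> E" "x = f (z + e)"
        using x by (auto elim: hutchinson_E)
      obtain y where y: "y \<in> X" "norm (z - (f ^^ j) y) \<le> b"
        using b[OF z(1)] by blast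
      have "x - (f ^^ Suc j) y = f ((z - (f ^^ j) y) + e)"
        using f z(3) by (simp add: linear_diff linear_add)
      also have "norm \<dots> \<le> B * norm ((z - (f ^^ j) y) + e)"
        by (rule B)
      also have "\<dots> \<le> B * (b + c)"
      proof (rule mult_left_mono)
        have "norm e \<le> c"
          unfolding c_def using E z(2) by simp
        then show "norm ((z - (f ^^ j) y) + e) \<le> b + c"
          using y(2) norm_triangle_ineq[of "z - (f ^^ j) y" e] by linarith
      qed (use B in simp)
      finally show ?thesis
        using y(1) by blast
    qed
    then show ?case by blast
  qed
  from approx[of k] obtain b where b: "\<And>X x. x \<in> (?H ^^ k) X \<Longrightarrow> \<exists>y\<in>X. norm (x - (f ^^ k) y) \<le> b"
    by blast
  \<comment> \<open>The radius is chosen such that half of it absorbs the error: \<open>\<rho> / 2 + b \<le> \<rho>\<close>.\<close>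
  define \<rho> where "\<rho> = 2 * max b 0"
  define B where "B = cball (0 :: 'a) \<rho>"
  have sub: "(?H ^^ k) B \<subseteq> B"
  proof
    fix x assume "x \<in> (?H ^^ k) B"
    then obtain y where y: "norm y \<le> \<rho>" "norm (x - (f ^^ k) y) \<le> b"
      using b[of x B] by (auto simp: B_def)
    have "C k * norm y \<le> 1 / 2 * norm y"
      using k(1) by (intro mult_right_mono) auto
    also have "\<dots> \<le> 1 / 2 * \<rho>"
      using y(1) by simp
    finally have "norm ((f ^^ k) y) \<le> \<rho> / 2"
      using C(2)[of k y] by simp
    then have "norm x \<le> \<rho> / 2 + b"
      using y(2) norm_triangle_ineq[of "x - (f ^^ k) y" "(f ^^ k) y"] by simp
    moreover have "b \<le> \<rho> / 2"
      by (simp add: \<rho>_def)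
    ultimately show "x \<in> B"
      by (simp add: B_def)
  qed
  define K where "K = (\<Union>i<k. (?H ^^ i) B)"
  have "compact ((?H ^^ i) B)" for i
    by (induction i) (simp_all add: B_def compact_hutchinson f E)
  then have "compact K"
    unfolding K_def by (intro compact_UN) auto
  moreover have "0 \<in> (?H ^^ 0) B"
    by (simp add: B_def \<rho>_def)
  then have "K \<noteq> {}"
    unfolding K_def using k(2) by blast
  moreover have "?H K \<subseteq> K"
  proof
    fix x assume "x \<in> ?H K"
    then obtain y e where y: "y \<in> K" "e \<in> E" "x = f (y + e)"
      by (rule hutchinson_E)
    then obtain i where i: "i < k" "y \<in> (?H ^^ i) B"
      unfolding K_def by blast
    then have x: "x \<in> (?H ^^ Suc i) B"
      using hutchinson_I[OF i(2) y(2)] y(3) by simp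
    show "x \<in> K"
    proof (cases "Suc i = k")
      case True
      then have "x \<in> (?H ^^ 0) B"
        using x sub by auto
      then show ?thesis
        using k(2) unfolding K_def by blast
    next
      case False
      then have "Suc i < k"
        using i(1) by simp
      then show ?thesis
        using x unfolding K_def by blast
    qed
  qed
  ultimately show thesis
    by (rule that)
qed

text \<open>
  Existence: intersect the decreasing images of an invariant compact set. A point of the
  intersection has a preimage in every image; one digit serves for all of them, as there are
  finitely many digits and the sets decrease, and injectivity of \<open>f\<close> makes the preimage unique, so
  it lies in the intersection. Uniqueness: compare two fixed points in both directions.
\<close>
lemma hutchinson_fixed_point_ex1:
  fixes f :: "'a::euclidean_space \<Rightarrow> 'a"
  assumes f: "linear f" "inj f" and lim: "\<And>x. (\<lambda>k. (f ^^ k) x) \<longlonglongrightarrow> 0"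
    and E: "finite E" "E \<noteq> {}"
  shows "\<exists>!T. compact T \<and> T \<noteq> {} \<and> T = hutchinson f E T"
proof (rule ex_ex1I)
  let ?H = "hutchinson f E"
  obtain K where K: "compact K" "K \<noteq> {}" "?H K \<subseteq> K"
    using invariant_compact_exists[OF f(1) lim E] .
  define F where "F i = (?H ^^ i) K" for i
  have F_Suc: "F (Suc i) = ?H (F i)" for i
    by (simp add: F_def)
  have compact: "compact (F i)" for i
    by (induction i) (simp_all add: F_def K compact_hutchinson f E)
  have ne: "F i \<noteq> {}" for i
    by (induction i) (use K E in \<open>auto simp: F_def hutchinson_def\<close>)
  have "F (Suc i) \<subseteq> F i" for i
    by (induction i) (use K in \<open>simp_all add: F_def hutchinson_mono\<close>)
  then have anti: "F j \<subseteq> F i" if "i \<le> j" for i j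
    using lift_Suc_antimono_le[of F] that by blast
  define T where "T = (\<Inter>i. F i)"
  have H_T: "?H T \<subseteq> F i" for i
  proof -
    have "?H T \<subseteq> F (Suc i)"
      unfolding F_Suc by (rule hutchinson_mono) (auto simp: T_def)
    then show ?thesis
      using anti[of i "Suc i"] by auto
  qed
  have "?H T \<subseteq> T"
  proof
    fix x assume "x \<in> ?H T"
    then have "x \<in> F i" for i
      using H_T by blast
    then show "x \<in> T"
      by (simp add: T_def)
  qed
  moreover have "T \<subseteq> ?H T"
  proof
    fix x assume "x \<in> T"
    have "\<exists>e\<in>E. \<forall>i. x \<in> (\<lambda>y. f (y + e)) ` F i"
    proof (rule ccontr)
      assume "\<not> ?thesis"
      then have "\<forall>e\<in>E. \<exists>i. x \<notin> (\<lambda>y. f (y + e)) ` F i"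
        by blast
      then obtain i where i: "\<And>e. e \<in> E \<Longrightarrow> x \<notin> (\<lambda>y. f (y + e)) ` F (i e)"
        by metis
      define m where "m = Max (i ` E)"
      have "x \<notin> (\<lambda>y. f (y + e)) ` F m" if "e \<in> E" for e
      proof -
        have "i e \<le> m"
          unfolding m_def using E that by simp
        then show ?thesis
          using i[OF that] anti by blast
      qed
      then have "x \<notin> F (Suc m)"
        unfolding F_Suc hutchinson_def by blast
      then show False
        using \<open>x \<in> T\<close> unfolding T_def by blast
    qed
    then obtain e where e: "e \<in> E" "\<And>i. x \<in> (\<lambda>y. f (y + e)) ` F i"
      by blast
    then obtain y where y: "x = f (y + e)"
      by blast
    have "y \<in> F i" for i
    proof -
      obtain z where z: "z \<in> F i" "x = f (z + e)"
        using e(2) by blast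
      have "z + e = y + e"
        using f(2) by (rule injD) (use y z(2) in simp)
      then show ?thesis
        using z(1) by simp
    qed
    then show "x \<in> ?H T"
      unfolding y T_def using e(1) by (intro hutchinson_I) auto
  qed
  ultimately have "T = ?H T"
    by (rule equalityI[rotated])
  moreover have "T \<noteq> {}"
    unfolding T_def using compact ne anti by (rule compact_nest)
  moreover have "compact T"
    unfolding T_def using compact by (intro compact_Inter) auto
  ultimately show "\<exists>T. compact T \<and> T \<noteq> {} \<and> T = ?H T"
    by (intro exI[of _ T] conjI)
next
  have le: "T \<subseteq> U" if T: "compact T" "T = hutchinson f E T"
    and U: "compact U" "U \<noteq> {}" "U = hutchinson f E U" for T U
    using hutchinson_fixed_points_le[OF f(1) lim compact_imp_bounded[OF T(1)] equalityD1[OF T(2)]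
        U(1,2) equalityD2[OF U(3)]] .
  fix T U
  assume T: "compact T \<and> T \<noteq> {} \<and> T = hutchinson f E T"
    and U: "compact U \<and> U \<noteq> {} \<and> U = hutchinson f E U"
  note T = T[THEN conjunct1] T[THEN conjunct2, THEN conjunct1] T[THEN conjunct2, THEN conjunct2]
  note U = U[THEN conjunct1] U[THEN conjunct2, THEN conjunct1] U[THEN conjunct2, THEN conjunct2]
  show "T = U"
  proof (rule equalityI)
    show "T \<subseteq> U"
      using T(1,3) U by (rule le)
    show "U \<subseteq> T"
      using U(1,3) T by (rule le)
  qed
qed

text \<open>
  A kernel vector of \<open>R\<close> would be an eigenvector for the eigenvalue \<open>0\<close>.
\<close>
lemma det_nonzero_if_expanding:
  fixes R :: "int ^ 'n ^ 'n::finite"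
  assumes "expanding R"
  shows "det R \<noteq> 0"
proof
  assume "det R = 0"
  have "det (complex_mat R) = of_int (det R)"
    by (simp add: det_def complex_mat_def)
  with \<open>det R = 0\<close> have "\<not> invertible (complex_mat R)"
    by (simp add: invertible_det_nz)
  then have "\<not> (\<forall>v. complex_mat R *v v = 0 \<longrightarrow> v = 0)"
    by (simp only: invertible_left_inverse matrix_left_invertible_ker not_False_eq_True)
  then obtain v where v: "v \<noteq> 0" "complex_mat R *v v = 0"
    by blast
  have "complex_mat R *v v = 0 *s v"
    unfolding v(2) by simp
  with v(1) have "cmod 0 > 1"
    using assms unfolding expanding_def by blast
  then show False
    by simp
qed

text \<open>
  Existence and uniqueness of the attractor are what gives meaning to the definite description in
  \<open>self_affine_set\<close>.
\<close>
lemma self_affine_set_fixed_point: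
  fixes R :: "int ^ 'n ^ 'n::finite"
  assumes R: "expanding R" and D: "finite D" "D \<noteq> {}"
  shows "compact (self_affine_set R D)"
    and "self_affine_set R D =
      hutchinson ((*v) (matrix_inv (real_mat R))) (real_vec ` D) (self_affine_set R D)"
proof -
  define M where "M = matrix_inv (real_mat R)"
  have inv: "real_mat R *v (M *v x) = x" for x
    unfolding M_def by (rule invertible_real_mat) (rule det_nonzero_if_expanding[OF R])
  then have "real_mat R ** M = mat 1"
    by (simp add: matrix_eq flip: matrix_vector_mul_assoc)
  then have lim: "(\<lambda>k. ((*v) M ^^ k) x) \<longlonglongrightarrow> 0" for x
    by (rule iterates_tendsto_0_if_inverse_expanding[OF R])
  have "inj ((*v) M)"
    using inv by (metis injI)
  then have "\<exists>!T. compact T \<and> T \<noteq> {} \<and> T = hutchinson ((*v) M) (real_vec ` D) T"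
    using D by (intro hutchinson_fixed_point_ex1 lim) auto
  moreover have hutchinson_eq: "hutchinson ((*v) M) (real_vec ` D) X =
      (\<Union>d\<in>D. (\<lambda>x. M *v (x + real_vec d)) ` X)" for X
    by (simp add: hutchinson_def)
  ultimately have ex1: "\<exists>!T. compact T \<and> T \<noteq> {} \<and>
      T = (\<Union>d\<in>D. (\<lambda>x. M *v (x + real_vec d)) ` T)"
    by (simp only:)
  have fixed: "compact (self_affine_set R D) \<and> self_affine_set R D \<noteq> {} \<and>
      self_affine_set R D = (\<Union>d\<in>D. (\<lambda>x. M *v (x + real_vec d)) ` self_affine_set R D)"
    unfolding self_affine_set_def M_def[symmetric] by (rule theI'[OF ex1])
  then show "compact (self_affine_set R D)"
    by (rule conjunct1)
  show "self_affine_set R D =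
      hutchinson ((*v) (matrix_inv (real_mat R))) (real_vec ` D) (self_affine_set R D)"
    unfolding M_def[symmetric] hutchinson_eq
    by (rule fixed[THEN conjunct2, THEN conjunct2])
qed

lemma card_iter_digits_le:
  assumes "finite D"
  shows "card (iter_digits R D k) \<le> card D ^ k"
proof (induction k)
  case (Suc k)
  have "card (iter_digits R D (Suc k)) \<le> card D * card ((*v) R ` iter_digits R D k)"
    unfolding iter_digits_Suc using assms finite_iter_digits[OF assms]
    by (intro card_set_plus_le) auto
  also have "\<dots> \<le> card D * card D ^ k"
    using Suc card_image_le[OF finite_iter_digits[OF assms]] by (meson mult_le_mono2 order_trans)
  finally show ?case by simp
qed simp

text \<open>
  Iterating the fixed point equation gives \<open>T = \<Union>\<^sub>e R\<^sup>-\<^sup>k (T + e)\<close> over \<open>e \<in> D\<^sub>k\<close>, hence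
  \<open>vol T \<le> #D\<^sub>k |det R|\<^sup>-\<^sup>k vol T\<close>. Since the interior of \<open>T\<close> is non-empty, \<open>vol T > 0\<close>, so
  \<open>#D\<^sub>k \<ge> |det R|\<^sup>k = (#D)\<^sup>k\<close>, and \<open>D\<^sub>k\<close> cannot have more than \<open>(#D)\<^sup>k\<close> elements.
\<close>
lemma card_iter_digits_if_tile:
  fixes R :: "int ^ 'n ^ 'n::finite"
  assumes R: "expanding R" and D: "finite D" "int (card D) = \<bar>det R\<bar>"
    and tile: "is_self_affine_tile R D"
  shows "int (card (iter_digits R D k)) = \<bar>det (matpow R k)\<bar>"
proof -
  define M where "M = matrix_inv (real_mat R)"
  define T where "T = self_affine_set R D"
  have det: "det R \<noteq> 0"
    using R by (rule det_nonzero_if_expanding)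
  then have "D \<noteq> {}"
    using D by auto
  then have T: "compact T" "T = hutchinson ((*v) M) (real_vec ` D) T"
    unfolding T_def M_def by (rule self_affine_set_fixed_point[OF R D(1)])+
  have expand: "\<exists>y\<in>T. \<exists>e\<in>iter_digits R D k. x = ((*v) M ^^ k) (y + real_vec e)" if "x \<in> T" for x k
    using that
  proof (induction k arbitrary: x)
    case 0
    have "real_vec (0 :: int ^ 'n) = 0"
      by (simp add: real_vec_def vec_eq_iff)
    then show ?case
      using 0 by simp
  next
    case (Suc k)
    obtain y e where y: "y \<in> T" "e \<in> iter_digits R D k" "x = ((*v) M ^^ k) (y + real_vec e)"
      using Suc by blast
    have "y \<in> hutchinson ((*v) M) (real_vec ` D) T"
      unfolding T(2)[symmetric] by (rule y(1))
    then obtain z d where z: "z \<in> T" "d \<in> D" "y = M *v (z + real_vec d)"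
      by (blast elim: hutchinson_E)
    have "real_vec e = M *v real_vec (R *v e)"
      using det by (simp add: M_def real_vec_mult invertible_real_mat)
    then have "x = ((*v) M ^^ Suc k) (z + real_vec (d + R *v e))"
      using y(3) z(3)
      by (simp add: funpow_Suc_right real_vec_add matrix_vector_right_distrib add.assoc del: funpow.simps)
    moreover have "d + R *v e \<in> iter_digits R D (Suc k)"
      unfolding iter_digits_Suc using z y by blast
    ultimately show ?case
      using z(1) by blast
  qed
  have scale: "((*v) M ^^ k) ` S \<in> lmeasurable \<and>
    measure lebesgue (((*v) M ^^ k) ` S) = \<bar>det M\<bar> ^ k * measure lebesgue S"
    if "S \<in> lmeasurable" for S k
  proof (induction k)
    case (Suc k)
    have image: "((*v) M ^^ Suc k) ` S = (*v) M ` ((*v) M ^^ k) ` S"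
      by (simp add: image_image)
    have meas: "((*v) M ^^ k) ` S \<in> lmeasurable"
      using Suc by blast
    show ?case
      unfolding image measure_matrix_image[OF meas] using measurable_matrix_image[OF meas] Suc
      by simp
  qed (use that in simp)
  define D' where "D' = iter_digits R D k"
  have finD': "finite D'"
    unfolding D'_def using D(1) by (rule finite_iter_digits)
  have T_meas: "T \<in> lmeasurable"
    using T(1) by (rule lmeasurable_compact)
  define P where "P e = ((*v) M ^^ k) ` (+) (real_vec e) ` T" for e
  have P: "P e \<in> lmeasurable" "measure lebesgue (P e) = \<bar>det M\<bar> ^ k * measure lebesgue T" for e
    using scale[OF measurable_translation[OF T_meas]] by (simp_all add: P_def measure_translation)
  have "T \<subseteq> (\<Union>e\<in>D'. P e)"
  proof
    fix x assume "x \<in> T"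
    then obtain y e where "y \<in> T" "e \<in> D'" "x = ((*v) M ^^ k) (y + real_vec e)"
      using expand unfolding D'_def by blast
    then show "x \<in> (\<Union>e\<in>D'. P e)"
      unfolding P_def by (auto simp: add.commute)
  qed
  then have "measure lebesgue T \<le> measure lebesgue (\<Union>e\<in>D'. P e)"
    using T_meas P(1) finD' by (intro measure_mono_fmeasurable fmeasurableD fmeasurable.finite_UN) auto
  also have "\<dots> \<le> (\<Sum>e\<in>D'. measure lebesgue (P e))"
    using P(1) finD' by (intro measure_UNION_le fmeasurableD)
  also have "\<dots> = real (card D') * \<bar>det M\<bar> ^ k * measure lebesgue T"
    by (simp add: P(2))
  finally have le: "measure lebesgue T \<le> real (card D') * \<bar>det M\<bar> ^ k * measure lebesgue T" .
  have "measure lebesgue T > 0"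
  proof -
    have "interior T \<noteq> {}"
      using tile by (simp add: is_self_affine_tile_def T_def)
    then have "\<not> negligible T"
      using open_not_negligible[OF open_interior] negligible_subset[OF _ interior_subset] by blast
    then show ?thesis
      using T_meas by (simp add: negligible_iff_measure zero_less_measure_iff)
  qed
  moreover have "1 * measure lebesgue T \<le> (real (card D') * \<bar>det M\<bar> ^ k) * measure lebesgue T"
    using le by simp
  ultimately have "1 \<le> real (card D') * \<bar>det M\<bar> ^ k"
    by (simp only: mult_le_cancel_right_pos)
  moreover have "\<bar>det M\<bar> = inverse \<bar>real_of_int (det R)\<bar>"
    using det by (simp add: M_def invertible_real_mat)
  ultimately have "\<bar>real_of_int (det R)\<bar> ^ k \<le> real (card D')"
    using det by (simp add: power_inverse field_simps)
  then have "real_of_int (\<bar>det R\<bar> ^ k) \<le> real_of_int (int (card D'))"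
    by simp
  then have "\<bar>det R\<bar> ^ k \<le> int (card D')"
    by (simp only: of_int_le_iff)
  moreover have "int (card D') \<le> int (card D ^ k)"
    unfolding D'_def using card_iter_digits_le[OF D(1)] by (simp only: of_nat_le_iff)
  then have "int (card D') \<le> \<bar>det R\<bar> ^ k"
    by (simp add: D(2))
  ultimately show ?thesis
    by (simp add: abs_det_matpow D'_def)
qed

theorem theorem1p2:
  fixes R :: "int ^ 'n ^ 'n::finite" and D :: "(int ^ 'n) set"
  assumes "expanding R"
    and "0 \<in> D" and "finite D" and "int (card D) = \<bar>det R\<bar>"
    and "is_self_affine_tile R D"
  shows "((\<exists>m\<ge>1. \<exists>J. full_periodic (matpow R m) J \<and> 0 \<in> J \<and>
                    J = (*v) (matpow R m) ` J + iter_digits R D m)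
          \<longleftrightarrow> (\<exists>m\<ge>1. skew_product_form (matpow R m) (iter_digits R D m)))
       \<and> ((\<exists>m\<ge>1. skew_product_form (matpow R m) (iter_digits R D m))
          \<longleftrightarrow> (\<exists>m\<ge>1. Jstar R D (m + 1) = Jstar R D m))"
proof -
  have det: "det R \<noteq> 0"
    using assms(1) by (rule det_nonzero_if_expanding)
  then have det_pow: "det (matpow R m) \<noteq> 0" for m
  proof -
    have "\<bar>det (matpow R m)\<bar> \<noteq> 0"
      using det by (simp add: abs_det_matpow)
    then show ?thesis
      by simp
  qed
  have skew_iff: "skew_product_form (matpow R m) (iter_digits R D m) \<longleftrightarrow> Jstar R D (m + 1) = Jstar R D m"
    (is "?skew \<longleftrightarrow> ?stable") if "m \<ge> 1" for m
  proof
    assume ?skew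
    then have "\<exists>J. full_periodic (matpow R m) J \<and> 0 \<in> J \<and>
        J = (*v) (matpow R m) ` J + iter_digits R D m"
      using det_pow zero_in_iter_digits[OF assms(2)]
      by (rule skew_product_form_imp_periodic_solution)
    then show ?stable
      using periodic_solution_iff_Jstar_stable[OF det assms(2,3) that] by (rule iffD1[rotated])
  next
    assume ?stable
    then have "Jstar R D m = (*v) (matpow R m) ` Jstar R D m + iter_digits R D m"
      using Jstar_stable[of R D m m] Jstar_add[of R D m m] by simp
    then show ?skew
      by (rule skew_product_form_if_invariant[OF det_pow finite_iter_digits[OF assms(3)]
            card_iter_digits_if_tile[OF assms(1,3-5)] Jstar_eq])
  qed
  show ?thesis
    by (simp add: periodic_solution_iff_Jstar_stable[OF det assms(2,3)] skew_iff cong: conj_cong)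
qed

end
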